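(* Let $\sigma>0$, $k>0$, $n\ge1$, $P=\mathcal N(0,\sigma^2)$, and consider the program of minimizing $J(y,\zeta)=k^2\sum_{j=1}^n\int_{\zeta_{j-1}}^{\zeta_j}(x-y_j)^2\,dP+\operatorname{mmse}(Q_n)$ over levels $y_1<\dots<y_n$ and thresholds $\zeta_1<\dots<\zeta_{n-1}$, whose interior stationarity conditions are $$y_i-\bar x_i=-\frac{\partial_{y_i}\operatorname{mmse}(Q_n)}{2k^2w_i},\qquad \zeta_i=\frac{y_i+y_{i+1}}2+\frac{\Psi(y_{i+1})-\Psi(y_i)}{2k^2(y_{i+1}-y_i)}.$$ As $k\to\infty$ the MMSE corrections (the terms containing $\operatorname{mmse}$ and $\Psi$) vanish and the stationarity conditions become $$y_i=\bar x_i\ \text{(centroid)},\qquad \zeta_i=\tfrac12(y_i+y_{i+1})\ \text{(midpoint)}:$$ the bins are the Voronoi cells of the levels and each level is the centroid of its cell, which are exactly the Lloyd–Max optimality conditions for the $n$-point quantization of $P$.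
   Context: $I_i=(\zeta_{i-1},\zeta_i]$ with $\zeta_0=-\infty$, $\zeta_n=+\infty$; $w_i=P(I_i)$; $\bar x_i=w_i^{-1}\int_{I_i}x\,dP$; $Q_n=\sum_iw_i\delta_{y_i}$. $\phi$ is the standard normal density; $\operatorname{mmse}(Q)=\mathbb E[\operatorname{Var}(Y\mid Y+N)]$ for independent $Y\sim Q$, $N\sim\mathcal N(0,1)$; $\partial_{y_i}\operatorname{mmse}(Q_n)$ is taken with weights fixed. $\Psi(y)=y^2-2y\,a(y)+b(y)$ with $a(y)=\int m(z)\phi(z-y)\,dz$, $b(y)=\int m(z)^2\phi(z-y)\,dz$, $m(z)=\mathbb E[Y\mid Y+N=z]$ for $Y\sim Q_n$. The Lloyd–Max conditions for $n$-point quantization of $P$ are the stationarity conditions of $\sum_j\int_{I_j}(x-y_j)^2dP$ in $(y,\zeta)$. *)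

theory Defs
  imports "HOL-Probability.Probability"
begin

section \<open>Conditional expectation and variance given a real random variable\<close>

abbreviation sigma_gen :: "'a measure \<Rightarrow> ('a \<Rightarrow> real) \<Rightarrow> 'a measure" where
  "sigma_gen M Z \<equiv> vimage_algebra (space M) Z borel"

definition cond_var :: "'a measure \<Rightarrow> ('a \<Rightarrow> real) \<Rightarrow> ('a \<Rightarrow> real) \<Rightarrow> 'a \<Rightarrow> real" where
  "cond_var M X Z =
     real_cond_exp M (sigma_gen M Z)
       (\<lambda>\<omega>. (X \<omega> - real_cond_exp M (sigma_gen M Z) X \<omega>)\<^sup>2)"

text \<open>
  The function \<open>z \<mapsto> E[X | Z = z]\<close> is determined only up to null sets of the law of \<open>Z\<close>;
  \<open>cond_exp_at\<close> is one measurable version.  Below, \<open>Z\<close> always has an everywhere positive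
  Lebesgue density and the function is only used under Lebesgue integrals, so the choice is
  immaterial there.
\<close>

definition cond_exp_at :: "'a measure \<Rightarrow> ('a \<Rightarrow> real) \<Rightarrow> ('a \<Rightarrow> real) \<Rightarrow> real \<Rightarrow> real" where
  "cond_exp_at M X Z =
     (SOME g. g \<in> borel_measurable borel \<and>
        (AE \<omega> in M. g (Z \<omega>) = real_cond_exp M (sigma_gen M Z) X \<omega>))"

section \<open>The additive Gaussian channel\<close>

definition gaussian :: "real \<Rightarrow> real measure" where
  "gaussian \<sigma> = density lborel (normal_density 0 \<sigma>)"

text \<open>
  Canonical model of independent \<open>Y \<sim> Q\<close> and \<open>N \<sim> N(0,1)\<close>: on the product space,
  \<open>Y = fst\<close>, \<open>N = snd\<close>.
\<close>

definition channel :: "real measure \<Rightarrow> (real \<times> real) measure" where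
  "channel Q = Q \<Otimes>\<^sub>M gaussian 1"

definition mmse :: "real measure \<Rightarrow> real" where
  "mmse Q = (\<integral>\<omega>. cond_var (channel Q) fst (\<lambda>\<omega>. fst \<omega> + snd \<omega>) \<omega> \<partial>channel Q)"

definition post_mean :: "real measure \<Rightarrow> real \<Rightarrow> real" where
  "post_mean Q = cond_exp_at (channel Q) fst (\<lambda>\<omega>. fst \<omega> + snd \<omega>)"

definition a_fun :: "real measure \<Rightarrow> real \<Rightarrow> real" where
  "a_fun Q y = (\<integral>z. post_mean Q z * std_normal_density (z - y) \<partial>lborel)"

definition b_fun :: "real measure \<Rightarrow> real \<Rightarrow> real" where
  "b_fun Q y = (\<integral>z. (post_mean Q z)\<^sup>2 * std_normal_density (z - y) \<partial>lborel)"

definition Psi :: "real measure \<Rightarrow> real \<Rightarrow> real" where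
  "Psi Q y = y\<^sup>2 - 2 * y * a_fun Q y + b_fun Q y"

section \<open>Quantizers with \<open>n\<close> levels\<close>

text \<open>
  Levels are \<open>y 1, \<dots>, y n\<close> and finite thresholds are \<open>\<zeta> 1, \<dots>, \<zeta> (n - 1)\<close>; all other values
  of \<open>y\<close> and \<open>\<zeta>\<close> are irrelevant.
\<close>

definition admissible :: "nat \<Rightarrow> (nat \<Rightarrow> real) \<Rightarrow> (nat \<Rightarrow> real) \<Rightarrow> bool" where
  "admissible n y \<zeta> \<longleftrightarrow> strict_mono_on {1..n} y \<and> strict_mono_on {1..<n} \<zeta>"

definition threshold :: "nat \<Rightarrow> (nat \<Rightarrow> real) \<Rightarrow> nat \<Rightarrow> ereal" where
  "threshold n \<zeta> i = (if i = 0 then -\<infinity> else if i = n then \<infinity> else ereal (\<zeta> i))"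

definition bin :: "nat \<Rightarrow> (nat \<Rightarrow> real) \<Rightarrow> nat \<Rightarrow> real set" where
  "bin n \<zeta> i = {x. threshold n \<zeta> (i - 1) < ereal x \<and> ereal x \<le> threshold n \<zeta> i}"

definition weight :: "real measure \<Rightarrow> nat \<Rightarrow> (nat \<Rightarrow> real) \<Rightarrow> nat \<Rightarrow> real" where
  "weight P n \<zeta> i = measure P (bin n \<zeta> i)"

definition centroid :: "real measure \<Rightarrow> real set \<Rightarrow> real" where
  "centroid P A = (LINT x:A|P. x) / measure P A"

text \<open>The measure \<open>\<Sum>i = 1..n. w i \<cdot> \<delta>(y i)\<close>, as the image under \<open>y\<close> of the weights on \<open>{1..n}\<close>.\<close>

definition atoms :: "nat \<Rightarrow> (nat \<Rightarrow> real) \<Rightarrow> (nat \<Rightarrow> real) \<Rightarrow> real measure" where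
  "atoms n w y = distr (point_measure {1..n} (\<lambda>i. ennreal (w i))) borel y"

definition quantized :: "real measure \<Rightarrow> nat \<Rightarrow> (nat \<Rightarrow> real) \<Rightarrow> (nat \<Rightarrow> real) \<Rightarrow> real measure" where
  "quantized P n y \<zeta> = atoms n (weight P n \<zeta>) y"

definition voronoi :: "nat \<Rightarrow> (nat \<Rightarrow> real) \<Rightarrow> nat \<Rightarrow> real set" where
  "voronoi n y i = {x. \<forall>j\<in>{1..n}. dist x (y i) \<le> dist x (y j)}"

section \<open>Objective functions and stationarity\<close>

definition distortion :: "real measure \<Rightarrow> nat \<Rightarrow> (nat \<Rightarrow> real) \<Rightarrow> (nat \<Rightarrow> real) \<Rightarrow> real" where
  "distortion P n y \<zeta> = (\<Sum>j=1..n. LINT x:bin n \<zeta> j|P. (x - y j)\<^sup>2)"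

definition objective :: "real measure \<Rightarrow> nat \<Rightarrow> real \<Rightarrow> (nat \<Rightarrow> real) \<Rightarrow> (nat \<Rightarrow> real) \<Rightarrow> real" where
  "objective P n k y \<zeta> = k\<^sup>2 * distortion P n y \<zeta> + mmse (quantized P n y \<zeta>)"

definition stationary ::
  "nat \<Rightarrow> ((nat \<Rightarrow> real) \<Rightarrow> (nat \<Rightarrow> real) \<Rightarrow> real) \<Rightarrow> (nat \<Rightarrow> real) \<Rightarrow> (nat \<Rightarrow> real) \<Rightarrow> bool" where
  "stationary n F y \<zeta> \<longleftrightarrow>
     (\<forall>i\<in>{1..n}. ((\<lambda>t. F (y(i := t)) \<zeta>) has_real_derivative 0) (at (y i))) \<and>
     (\<forall>i\<in>{1..<n}. ((\<lambda>t. F y (\<zeta>(i := t))) has_real_derivative 0) (at (\<zeta> i)))"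

definition lloyd_max :: "real measure \<Rightarrow> nat \<Rightarrow> (nat \<Rightarrow> real) \<Rightarrow> (nat \<Rightarrow> real) \<Rightarrow> bool" where
  "lloyd_max P n y \<zeta> \<longleftrightarrow> stationary n (distortion P n) y \<zeta>"

text \<open>
  \<open>mmse_slice\<close> moves only the \<open>i\<close>-th level and keeps the weights at \<open>w\<close>; the partial derivative
  of \<open>mmse (quantized P n y \<zeta>)\<close> in \<open>y i\<close> with weights fixed is its derivative at \<open>y i\<close>.
\<close>

definition mmse_slice :: "nat \<Rightarrow> (nat \<Rightarrow> real) \<Rightarrow> (nat \<Rightarrow> real) \<Rightarrow> nat \<Rightarrow> real \<Rightarrow> real" where
  "mmse_slice n w y i t = mmse (atoms n w (y(i := t)))"

definition level_correction ::
  "real measure \<Rightarrow> nat \<Rightarrow> real \<Rightarrow> (nat \<Rightarrow> real) \<Rightarrow> (nat \<Rightarrow> real) \<Rightarrow> nat \<Rightarrow> real" where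
  "level_correction P n k y \<zeta> i =
     - (deriv (mmse_slice n (weight P n \<zeta>) y i) (y i) / (2 * k\<^sup>2 * weight P n \<zeta> i))"

definition threshold_correction ::
  "real measure \<Rightarrow> nat \<Rightarrow> real \<Rightarrow> (nat \<Rightarrow> real) \<Rightarrow> (nat \<Rightarrow> real) \<Rightarrow> nat \<Rightarrow> real" where
  "threshold_correction P n k y \<zeta> i =
     (Psi (quantized P n y \<zeta>) (y (i + 1)) - Psi (quantized P n y \<zeta>) (y i))
       / (2 * k\<^sup>2 * (y (i + 1) - y i))"

end

theory Submission
  imports Defs
begin

text \<open>
  For fixed weights \<open>w\<close> and levels \<open>y\<close>, the minimum mean squared error is the minimum over bounded
  estimators \<open>m\<close> of the risk \<open>\<Sum>j. w j * psi m (y j)\<close>, attained at the posterior mean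
  \<open>post n w y\<close>.  By the envelope theorem its partial derivatives are therefore those of the risk with
  the estimator frozen: \<open>psi\<close> at the two adjacent levels for a threshold, and \<open>w i\<close> times the
  derivative of \<open>psi\<close> for a level.  All levels being bounded by \<open>R\<close>, so is the posterior mean, which
  makes \<open>psi\<close> Lipschitz with a constant depending on \<open>R\<close> only; hence both corrections are at most
  this constant over \<open>2 * k\<^sup>2\<close>, uniformly along bounded families of levels.
\<close>

text \<open>The obstacle is that the optimal estimator moves with the parameter, so differentiating
  its risk directly would involve the derivative of the posterior mean. Optimality avoids this:
  increments of the MMSE are squeezed between increments of two risks, one with the estimator frozen
  at the base point and one with it frozen at the moving point. Both quotients have the same limit
  once posterior means converge pointwise under a common bound, because the derivative falls on the
  Gaussian kernel, whose difference quotients have one integrable majorant. Two cancellations keep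
  the bounds uniform: the level derivative carries the factor \<open>w i\<close> by which
  \<open>level_correction\<close> divides, and the Lipschitz estimate supplies the gap by which
  \<open>threshold_correction\<close> divides. Small weights and close levels therefore do no harm.
  The posterior mean of the definitions is known only up to null sets of the output law. The output
  density is positive, so these are Lebesgue null sets and Bayes' formula may replace it.\<close>

section \<open>Dominated convergence in a real parameter and the envelope theorem\<close>

text \<open>Limits at a real point can be tested on sequences. A majorant valid only for
  \<open>t\<close> near \<open>a\<close> suffices, since each sequence may be shifted past the
  finitely many terms that violate it.\<close>

lemma integral_dominated_convergence_at:
  fixes s :: "real \<Rightarrow> 'a \<Rightarrow> real"
  assumes f: "f \<in> borel_measurable M" and s: "\<And>t. s t \<in> borel_measurable M"
    and w: "integrable M w"
    and lim: "\<And>x. ((\<lambda>t. s t x) \<longlongrightarrow> f x) (at a)"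
    and bound: "\<forall>\<^sub>F t in at a. \<forall>x. \<bar>s t x\<bar> \<le> w x"
  shows "((\<lambda>t. integral\<^sup>L M (s t)) \<longlongrightarrow> integral\<^sup>L M f) (at a)"
  unfolding tendsto_at_iff_sequentially
proof (intro allI impI)
  fix X :: "nat \<Rightarrow> real"
  assume X: "\<forall>i. X i \<in> UNIV - {a}" "X \<longlonglongrightarrow> a"
  then have filt: "filterlim X (at a) sequentially"
    by (auto simp: filterlim_at)
  then have "\<forall>\<^sub>F i in sequentially. \<forall>x. \<bar>s (X i) x\<bar> \<le> w x"
    using bound by (rule eventually_compose_filterlim[rotated])
  then obtain N where N: "\<And>i x. i \<ge> N \<Longrightarrow> \<bar>s (X i) x\<bar> \<le> w x"
    by (auto simp: eventually_sequentially)
  have "(\<lambda>i. s (X i) x) \<longlonglongrightarrow> f x" for x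
    using filterlim_compose[OF lim filt] .
  then have "(\<lambda>i. s (X (i + N)) x) \<longlonglongrightarrow> f x" for x
    by (rule LIMSEQ_ignore_initial_segment)
  then have "(\<lambda>i. integral\<^sup>L M (s (X (i + N)))) \<longlonglongrightarrow> integral\<^sup>L M f"
    using N by (intro integral_dominated_convergence[OF f s w]) auto
  then show "((\<lambda>t. integral\<^sup>L M (s t)) \<circ> X) \<longlonglongrightarrow> integral\<^sup>L M f"
    unfolding o_def by (rule LIMSEQ_offset)
qed

text \<open>
  If \<open>F s\<close> lies above \<open>U\<close> and touches it at \<open>s\<close>, the increments of \<open>U\<close> between \<open>t0\<close> and \<open>t\<close>
  lie between those of \<open>F t\<close> and \<open>F t0\<close>.
\<close>

lemma has_real_derivative_envelope:
  fixes U :: "real \<Rightarrow> real" and F :: "real \<Rightarrow> real \<Rightarrow> real"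
  assumes touch: "U t0 = F t0 t0"
    and above: "\<forall>\<^sub>F t in at t0. U t = F t t \<and> U t \<le> F t0 t \<and> U t0 \<le> F t t0"
    and lim: "((\<lambda>t. (F t t - F t t0) / (t - t0)) \<longlongrightarrow> D) (at t0)"
    and lim0: "((\<lambda>t. (F t0 t - F t0 t0) / (t - t0)) \<longlongrightarrow> D) (at t0)"
  shows "(U has_real_derivative D) (at t0)"
  unfolding has_field_derivative_iff
proof (rule tendsto_sandwich)
  let ?a = "\<lambda>t. (F t t - F t t0) / (t - t0)" and ?b = "\<lambda>t. (F t0 t - F t0 t0) / (t - t0)"
  have ne: "\<forall>\<^sub>F t in at t0. t \<noteq> t0"
    by (simp add: eventually_at_filter)
  \<comment> \<open>Dividing by \<open>t - t0\<close> reverses inequalities to the left of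
    \<open>t0\<close>, so which quotient is the lower bound depends on the side. Taking
    \<open>min\<close> and \<open>max\<close> treats both sides at once.\<close>
  have between: "min (?a t) (?b t) \<le> (U t - U t0) / (t - t0) \<and> (U t - U t0) / (t - t0) \<le> max (?a t) (?b t)"
    if "U t = F t t \<and> U t \<le> F t0 t \<and> U t0 \<le> F t t0" "t \<noteq> t0" for t
  proof -
    have inc: "F t t - F t t0 \<le> U t - U t0" "U t - U t0 \<le> F t0 t - F t0 t0"
      using that touch by auto
    show ?thesis
    proof (cases "t > t0")
      case True
      then have "?a t \<le> (U t - U t0) / (t - t0)" "(U t - U t0) / (t - t0) \<le> ?b t"
        using inc by (auto intro: divide_right_mono)
      then show ?thesis by auto
    next
      case False
      then have "t - t0 \<le> 0" using that by auto
      then have "(U t - U t0) / (t - t0) \<le> ?a t" "?b t \<le> (U t - U t0) / (t - t0)"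
        using inc by (auto intro: divide_right_mono_neg)
      then show ?thesis by auto
    qed
  qed
  show "\<forall>\<^sub>F t in at t0. min (?a t) (?b t) \<le> (U t - U t0) / (t - t0)"
    using above ne by eventually_elim (use between in blast)
  show "\<forall>\<^sub>F t in at t0. (U t - U t0) / (t - t0) \<le> max (?a t) (?b t)"
    using above ne by eventually_elim (use between in blast)
  show "((\<lambda>t. min (?a t) (?b t)) \<longlongrightarrow> D) (at t0)"
    using tendsto_min[OF lim lim0] by simp
  show "((\<lambda>t. max (?a t) (?b t)) \<longlongrightarrow> D) (at t0)"
    using tendsto_max[OF lim lim0] by simp
qed

section \<open>Gaussian smoothing\<close>

lemma std_normal_density_diff:
  "std_normal_density (x - h) = std_normal_density x * exp (x * h - h\<^sup>2 / 2)"
proof -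
  have "- (x - h)\<^sup>2 / 2 = - x\<^sup>2 / 2 + (x * h - h\<^sup>2 / 2)"
    by (simp add: power2_eq_square field_simps)
  then have "exp (- (x - h)\<^sup>2 / 2) = exp (- x\<^sup>2 / 2) * exp (x * h - h\<^sup>2 / 2)"
    by (simp only: exp_add)
  then show ?thesis
    unfolding std_normal_density_def by simp
qed

lemma std_normal_density_translate:
  "std_normal_density (z - y) = normal_density y 1 z"
  by (simp add: normal_density_def)

lemma integrable_std_normal_density_translate [simp]:
  "integrable lborel (\<lambda>z. std_normal_density (z - y))"
  by (simp add: std_normal_density_translate)

lemma integral_std_normal_density_translate [simp]:
  "(\<integral>z. std_normal_density (z - y) \<partial>lborel) = 1"
  by (simp add: std_normal_density_translate)

text \<open>
  A common majorant of the difference quotients of \<open>std_normal_density\<close> with step at most 1,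
  chosen so that its integral is immediate.
\<close>

definition gauss_majorant :: "real \<Rightarrow> real" where
  "gauss_majorant x = exp 4 * (std_normal_density (x - 2) + std_normal_density (x + 2))"

lemma gauss_majorant_integrable [simp]: "integrable lborel (\<lambda>z. gauss_majorant (z - y))"
  using integrable_std_normal_density_translate[of "y + 2"]
    integrable_std_normal_density_translate[of "y - 2"]
  by (simp add: gauss_majorant_def algebra_simps)

lemma gauss_majorant_integral [simp]: "(\<integral>z. gauss_majorant (z - y) \<partial>lborel) = 2 * exp 4"
proof -
  have "(\<integral>z. gauss_majorant (z - y) \<partial>lborel)
      = (\<integral>z. exp 4 * (std_normal_density (z - (y + 2)) + std_normal_density (z - (y - 2))) \<partial>lborel)"
    by (simp add: gauss_majorant_def algebra_simps)
  also have "\<dots> = exp 4 * (1 + 1)"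
    by (subst integral_mult_right_zero, subst Bochner_Integration.integral_add) simp_all
  finally show ?thesis by simp
qed

text \<open>The ratio of the shifted to the unshifted density is \<open>exp u\<close>, and
  \<open>exp u - 1\<close> is at most \<open>\<bar>u\<bar> * exp \<bar>u\<bar>\<close>, hence at
  most \<open>\<bar>h\<bar> * exp (2 * \<bar>x\<bar> + 2)\<close>. Multiplying the density by
  \<open>exp (2 * x + 2)\<close> translates it by 2 and scales it by \<open>exp 4\<close>; the
  opposite sign translates it by -2. This is where the shifts and the constant of
  \<open>gauss_majorant\<close> come from.\<close>

lemma std_normal_density_diff_bound:
  assumes "\<bar>h\<bar> \<le> 1"
  shows "\<bar>std_normal_density (x - h) - std_normal_density x\<bar> \<le> \<bar>h\<bar> * gauss_majorant x"
proof -
  define u where "u = x * h - h\<^sup>2 / 2"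
  have "\<bar>u\<bar> \<le> \<bar>x * h\<bar> + \<bar>h\<^sup>2 / 2\<bar>" unfolding u_def by (rule abs_triangle_ineq4)
  moreover have "h\<^sup>2 \<le> \<bar>h\<bar> * 1"
    using mult_left_mono[OF assms, of "\<bar>h\<bar>"] by (simp add: power2_eq_square flip: abs_mult)
  ultimately have u: "\<bar>u\<bar> \<le> \<bar>h\<bar> * (\<bar>x\<bar> + 1)"
    by (simp add: abs_mult algebra_simps)
  moreover have "\<bar>h\<bar> * (\<bar>x\<bar> + 1) \<le> 1 * (\<bar>x\<bar> + 1)"
    using assms by (intro mult_right_mono) auto
  ultimately have u': "\<bar>u\<bar> \<le> \<bar>x\<bar> + 1" by simp
  have "\<bar>exp u - 1\<bar> \<le> \<bar>u\<bar> * exp \<bar>u\<bar>"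
  proof (cases "u \<ge> 0")
    case True
    have "(1 - u) * exp u \<le> exp (- u) * exp u"
      using exp_ge_add_one_self[of "- u"] by (intro mult_right_mono) auto
    then show ?thesis using True by (simp add: exp_minus algebra_simps)
  next
    case False
    then have "exp u \<le> 1" by simp
    then have "\<bar>exp u - 1\<bar> \<le> \<bar>u\<bar> * 1" using False exp_ge_add_one_self[of u] by linarith
    also have "\<dots> \<le> \<bar>u\<bar> * exp \<bar>u\<bar>" by (intro mult_left_mono) auto
    finally show ?thesis .
  qed
  also have "\<dots> \<le> (\<bar>h\<bar> * exp (\<bar>x\<bar> + 1)) * exp (\<bar>x\<bar> + 1)"
  proof (rule mult_mono)
    have "\<bar>x\<bar> + 1 \<le> exp (\<bar>x\<bar> + 1)" using exp_ge_add_one_self[of "\<bar>x\<bar> + 1"] by linarith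
    then show "\<bar>u\<bar> \<le> \<bar>h\<bar> * exp (\<bar>x\<bar> + 1)"
      using u by (meson abs_ge_zero mult_left_mono order_trans)
  qed (use u' in auto)
  also have "\<dots> = \<bar>h\<bar> * exp (2 * \<bar>x\<bar> + 2)"
    by (simp add: algebra_simps flip: exp_add)
  also have "\<dots> \<le> \<bar>h\<bar> * (exp (2 * x + 2) + exp (- 2 * x + 2))"
  proof (intro mult_left_mono)
    show "exp (2 * \<bar>x\<bar> + 2) \<le> exp (2 * x + 2) + exp (- 2 * x + 2)"
      by (cases "x \<ge> 0") auto
  qed simp
  finally have *: "\<bar>exp u - 1\<bar> \<le> \<bar>h\<bar> * (exp (2 * x + 2) + exp (- 2 * x + 2))" .
  have "\<bar>std_normal_density (x - h) - std_normal_density x\<bar> = std_normal_density x * \<bar>exp u - 1\<bar>"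
    unfolding std_normal_density_diff u_def[symmetric]
    using abs_mult[of "std_normal_density x" "exp u - 1"] by (simp add: algebra_simps)
  also have "\<dots> \<le> std_normal_density x * (\<bar>h\<bar> * (exp (2 * x + 2) + exp (- 2 * x + 2)))"
    using * by (intro mult_left_mono) auto
  also have "\<dots> = \<bar>h\<bar> * gauss_majorant x"
  proof -
    have "gauss_majorant x = exp 4 * (std_normal_density (x - 2) + std_normal_density (x - (-2)))"
      by (simp add: gauss_majorant_def)
    also have "\<dots> = std_normal_density x * (exp 4 * exp (2 * x - 2) + exp 4 * exp (- 2 * x - 2))"
      unfolding std_normal_density_diff by (simp add: algebra_simps)
    also have "exp 4 * exp (2 * x - 2) = exp (2 * x + 2)" 
      by (simp flip: exp_add)
    also have "exp 4 * exp (- 2 * x - 2) = exp (- 2 * x + 2)" 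
      by (simp flip: exp_add)
    finally show ?thesis by (simp add: algebra_simps)
  qed
  finally show ?thesis .
qed

lemma std_normal_density_has_real_derivative:
  "(std_normal_density has_real_derivative - x * std_normal_density x) (at x)"
  unfolding std_normal_density_def
  by (auto intro!: derivative_eq_intros simp: field_simps)

text \<open>This is the expectation of \<open>g (y + N)\<close> for standard normal
  \<open>N\<close>, that is, the mean of \<open>g\<close> at the output when the input is
  \<open>y\<close>. Both \<open>a_fun\<close> and \<open>b_fun\<close> have this shape.\<close>

definition smooth :: "(real \<Rightarrow> real) \<Rightarrow> real \<Rightarrow> real" where
  "smooth g y = (\<integral>z. g z * std_normal_density (z - y) \<partial>lborel)"

lemma smooth_integrable:
  assumes [measurable]: "g \<in> borel_measurable borel" and g: "\<And>z. \<bar>g z\<bar> \<le> R"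
  shows "integrable lborel (\<lambda>z. g z * std_normal_density (z - y))"
proof (rule Bochner_Integration.integrable_bound)
  show "integrable lborel (\<lambda>z. R * std_normal_density (z - y))" by simp
  show "AE z in lborel. norm (g z * std_normal_density (z - y)) \<le> norm (R * std_normal_density (z - y))"
    using order_trans[OF g abs_ge_self] by (auto simp: abs_mult intro!: mult_right_mono)
qed measurable

lemma smooth_bound:
  assumes "g \<in> borel_measurable borel" and g: "\<And>z. \<bar>g z\<bar> \<le> R"
  shows "\<bar>smooth g y\<bar> \<le> R"
proof -
  have "norm (smooth g y) \<le> (\<integral>z. norm (g z * std_normal_density (z - y)) \<partial>lborel)"
    unfolding smooth_def by (rule integral_norm_bound)
  also have "\<dots> \<le> (\<integral>z. R * std_normal_density (z - y) \<partial>lborel)"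
    using g by (intro integral_mono integrable_norm smooth_integrable[OF assms])
       (auto simp: abs_mult intro!: mult_right_mono)
  finally have "norm (smooth g y) \<le> (\<integral>z. R * std_normal_density (z - y) \<partial>lborel)" .
  then show ?thesis by simp
qed

lemma smooth_diff:
  assumes "g \<in> borel_measurable borel" and "\<And>z. \<bar>g z\<bar> \<le> R"
  shows "smooth g y - smooth g y'
    = (\<integral>z. g z * (std_normal_density (z - y) - std_normal_density (z - y')) \<partial>lborel)"
  unfolding smooth_def right_diff_distrib
  by (intro Bochner_Integration.integral_diff[symmetric] smooth_integrable[OF assms])

text \<open>For arguments at distance at most 1 the majorant applies, and its integral
  \<open>2 * exp 4\<close> is the constant. For larger distances the trivial bound
  \<open>2 * R\<close> is already smaller than the claim.\<close>

lemma smooth_lipschitz: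
  assumes [measurable]: "g \<in> borel_measurable borel" and g: "\<And>z. \<bar>g z\<bar> \<le> R"
  shows "\<bar>smooth g y - smooth g y'\<bar> \<le> 2 * exp 4 * R * \<bar>y - y'\<bar>"
proof (cases "\<bar>y - y'\<bar> \<le> 1")
  case True
  have R: "R \<ge> 0" using g[of 0] by linarith
  have "norm (smooth g y - smooth g y')
      \<le> (\<integral>z. norm (g z * (std_normal_density (z - y) - std_normal_density (z - y'))) \<partial>lborel)"
    unfolding smooth_diff[OF assms] by (rule integral_norm_bound)
  also have "\<dots> \<le> (\<integral>z. R * \<bar>y - y'\<bar> * gauss_majorant (z - y') \<partial>lborel)"
  proof (rule integral_mono)
    have "integrable lborel (\<lambda>z. g z * (std_normal_density (z - y) - std_normal_density (z - y')))"
      unfolding right_diff_distrib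
      by (intro Bochner_Integration.integrable_diff smooth_integrable[OF assms])
    then show "integrable lborel (\<lambda>z. norm (g z * (std_normal_density (z - y) - std_normal_density (z - y'))))"
      by (rule integrable_norm)
    fix z :: real
    have "\<bar>std_normal_density (z - y' - (y - y')) - std_normal_density (z - y')\<bar>
        \<le> \<bar>y - y'\<bar> * gauss_majorant (z - y')"
      using True by (rule std_normal_density_diff_bound)
    then show "norm (g z * (std_normal_density (z - y) - std_normal_density (z - y')))
        \<le> R * \<bar>y - y'\<bar> * gauss_majorant (z - y')"
      using g[of z] R by (auto simp: abs_mult mult.assoc intro!: mult_mono)
  qed simp
  finally show ?thesis by (simp add: algebra_simps)
next
  case False
  have R: "R \<ge> 0" using g[of 0] by linarith
  have "\<bar>smooth g y - smooth g y'\<bar> \<le> R + R"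
    using smooth_bound[OF assms, of y] smooth_bound[OF assms, of y'] by linarith
  also have "\<dots> \<le> 2 * R * \<bar>y - y'\<bar>"
    using False R mult_left_mono[of 1 "\<bar>y - y'\<bar>" "2 * R"] by simp
  also have "\<dots> \<le> exp 4 * (2 * R * \<bar>y - y'\<bar>)"
    using R mult_right_mono[of 1 "exp 4" "2 * R * \<bar>y - y'\<bar>"] by simp
  finally show ?thesis by (simp add: algebra_simps)
qed

lemma tendsto_smooth:
  fixes g :: "real \<Rightarrow> real \<Rightarrow> real"
  assumes [measurable]: "\<And>t. g t \<in> borel_measurable borel" "g0 \<in> borel_measurable borel"
    and bound: "\<forall>\<^sub>F t in at a. \<forall>z. \<bar>g t z\<bar> \<le> R"
    and lim: "\<And>z. ((\<lambda>t. g t z) \<longlongrightarrow> g0 z) (at a)"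
  shows "((\<lambda>t. smooth (g t) y) \<longlongrightarrow> smooth g0 y) (at a)"
  unfolding smooth_def
proof (rule integral_dominated_convergence_at)
  show "integrable lborel (\<lambda>z. R * std_normal_density (z - y))" by simp
  show "\<forall>\<^sub>F t in at a. \<forall>z. \<bar>g t z * std_normal_density (z - y)\<bar> \<le> R * std_normal_density (z - y)"
    using bound by eventually_elim (auto simp: abs_mult intro!: mult_right_mono)
qed (auto intro!: tendsto_intros lim)

text \<open>The function \<open>g t\<close> may change with the same \<open>t\<close> that moves the
  centre. The increment is taken with \<open>g t\<close> held fixed, so only the kernel is
  differentiated, and pointwise convergence of \<open>g t\<close> under a common bound is enough.
  The factor \<open>(z - a) * std_normal_density (z - a)\<close> is the derivative of the kernel in
  its centre.\<close>

lemma tendsto_smooth_quotient: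
  fixes g :: "real \<Rightarrow> real \<Rightarrow> real"
  assumes [measurable]: "\<And>t. g t \<in> borel_measurable borel" "g0 \<in> borel_measurable borel"
    and bound: "\<forall>\<^sub>F t in at a. \<forall>z. \<bar>g t z\<bar> \<le> R"
    and lim: "\<And>z. ((\<lambda>t. g t z) \<longlongrightarrow> g0 z) (at a)"
  shows "((\<lambda>t. (smooth (g t) t - smooth (g t) a) / (t - a))
    \<longlongrightarrow> (\<integral>z. g0 z * ((z - a) * std_normal_density (z - a)) \<partial>lborel)) (at a)"
proof -
  let ?q = "\<lambda>t z. (std_normal_density (z - t) - std_normal_density (z - a)) / (t - a)"
  have "((\<lambda>t. \<integral>z. g t z * ?q t z \<partial>lborel)
    \<longlongrightarrow> (\<integral>z. g0 z * ((z - a) * std_normal_density (z - a)) \<partial>lborel)) (at a)"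
  proof (rule integral_dominated_convergence_at)
    show "integrable lborel (\<lambda>z. R * gauss_majorant (z - a))" by simp
    have "\<forall>\<^sub>F t in at a. \<bar>t - a\<bar> \<le> 1"
      using eventually_at_ball[of 1 a UNIV] by (auto simp: dist_real_def elim!: eventually_mono)
    moreover have "\<forall>\<^sub>F t in at a. t \<noteq> a"
      by (simp add: eventually_at_filter)
    ultimately show "\<forall>\<^sub>F t in at a. \<forall>z. \<bar>g t z * ?q t z\<bar> \<le> R * gauss_majorant (z - a)"
      using bound
    proof eventually_elim
      case (elim t)
      have "\<bar>?q t z\<bar> \<le> gauss_majorant (z - a)" for z
        using std_normal_density_diff_bound[OF elim(1), of "z - a"] elim(2)
        by (simp add: abs_divide divide_le_eq mult.commute)
      moreover have "R \<ge> 0" using elim(3) by (meson abs_ge_zero order_trans)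
      ultimately show ?case
        using elim(3) unfolding abs_mult by (auto simp del: abs_divide intro!: mult_mono)
    qed
    fix z
    have "((\<lambda>t. z - t) has_real_derivative -1) (at a)"
      by (auto intro!: derivative_eq_intros)
    from DERIV_chain2[OF std_normal_density_has_real_derivative this]
    have "((\<lambda>t. std_normal_density (z - t)) has_real_derivative (z - a) * std_normal_density (z - a)) (at a)"
      by (simp add: algebra_simps)
    then show "((\<lambda>t. g t z * ?q t z) \<longlongrightarrow> g0 z * ((z - a) * std_normal_density (z - a))) (at a)"
      unfolding has_field_derivative_iff by (intro tendsto_mult lim)
  qed measurable
  moreover have "\<forall>\<^sub>F t in at a. (\<integral>z. g t z * ?q t z \<partial>lborel) = (smooth (g t) t - smooth (g t) a) / (t - a)"
    using bound
  proof eventually_elim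
    case (elim t)
    then have "smooth (g t) t - smooth (g t) a
        = (\<integral>z. g t z * (std_normal_density (z - t) - std_normal_density (z - a)) \<partial>lborel)"
      by (intro smooth_diff[of _ R]) auto
    then show ?case by simp
  qed
  ultimately show ?thesis by (rule Lim_transform_eventually)
qed

section \<open>The channel with a finitely supported input\<close>

lemma sets_gaussian [measurable_cong, simp]: "sets (gaussian \<sigma>) = sets borel"
  by (simp add: gaussian_def)

lemma space_gaussian [simp]: "space (gaussian \<sigma>) = UNIV"
  by (simp add: gaussian_def)

lemma prob_space_gaussian: "\<sigma> > 0 \<Longrightarrow> prob_space (gaussian \<sigma>)"
  unfolding gaussian_def by (rule prob_space_normal_density)

text \<open>For bounded measurable \<open>m\<close> this is the mean squared error of the estimator
  \<open>m\<close> given input \<open>y\<close>. The expanded form matches \<open>Psi\<close> and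
  reduces every analytic question to \<open>smooth\<close>.\<close>

definition psi :: "(real \<Rightarrow> real) \<Rightarrow> real \<Rightarrow> real" where
  "psi m y = y\<^sup>2 - 2 * y * smooth m y + smooth (\<lambda>z. (m z)\<^sup>2) y"

lemma abs_le_imp_power2_le: "\<bar>x\<bar> \<le> R \<Longrightarrow> \<bar>x\<^sup>2\<bar> \<le> R\<^sup>2" for x R :: real
  using power_mono[of "\<bar>x\<bar>" R 2] by simp

lemma psi_integral:
  assumes [measurable]: "m \<in> borel_measurable borel" and m: "\<And>z. \<bar>m z\<bar> \<le> R"
  shows "integrable lborel (\<lambda>z. (y - m z)\<^sup>2 * std_normal_density (z - y))"
    and "psi m y = (\<integral>z. (y - m z)\<^sup>2 * std_normal_density (z - y) \<partial>lborel)"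
proof -
  have 1: "integrable lborel (\<lambda>z. m z * std_normal_density (z - y))"
    using m by (intro smooth_integrable) auto
  have 2: "integrable lborel (\<lambda>z. (m z)\<^sup>2 * std_normal_density (z - y))"
    by (intro smooth_integrable[of _ "R\<^sup>2"] abs_le_imp_power2_le m) measurable
  have eq: "(y - m z)\<^sup>2 * std_normal_density (z - y)
      = y\<^sup>2 * std_normal_density (z - y) - 2 * y * (m z * std_normal_density (z - y))
        + (m z)\<^sup>2 * std_normal_density (z - y)" for z
    by (simp add: power2_eq_square algebra_simps)
  show "integrable lborel (\<lambda>z. (y - m z)\<^sup>2 * std_normal_density (z - y))"
    unfolding eq using 1 2 by simp
  show "psi m y = (\<integral>z. (y - m z)\<^sup>2 * std_normal_density (z - y) \<partial>lborel)"
    unfolding eq psi_def smooth_def using 1 2 by simp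
qed

text \<open>Bayes' formula for the posterior mean; the denominator is the Lebesgue density of the
  output.\<close>

definition post :: "nat \<Rightarrow> (nat \<Rightarrow> real) \<Rightarrow> (nat \<Rightarrow> real) \<Rightarrow> real \<Rightarrow> real" where
  "post n w y z = (\<Sum>j=1..n. w j * y j * std_normal_density (z - y j))
                  / (\<Sum>j=1..n. w j * std_normal_density (z - y j))"

lemma post_measurable [measurable]: "post n w y \<in> borel_measurable borel"
  unfolding post_def[abs_def] by measurable

definition prob_weights :: "nat \<Rightarrow> (nat \<Rightarrow> real) \<Rightarrow> bool" where
  "prob_weights n w \<longleftrightarrow> (\<forall>j\<in>{1..n}. w j > 0) \<and> (\<Sum>j=1..n. w j) = 1"

text \<open>The levels are unconstrained, neither ordered nor distinct, so every perturbation
  \<open>y(i := t)\<close> is again an instance. Accordingly \<open>y\<close> does not occur in the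
  predicate \<open>finite_input n w\<close>.\<close>

locale finite_input =
  fixes n :: nat and w y :: "nat \<Rightarrow> real"
  assumes weights: "prob_weights n w"
begin

lemma w_pos: "j \<in> {1..n} \<Longrightarrow> w j > 0"
  using weights by (simp add: prob_weights_def)

lemma w_sum: "(\<Sum>j=1..n. w j) = 1"
  using weights by (simp add: prob_weights_def)

lemma n_pos: "1 \<in> {1..n}"
  using w_sum by (cases n) auto

lemma output_density_pos: "(\<Sum>j=1..n. w j * std_normal_density (z - y j)) > 0"
  using n_pos by (intro sum_pos) (auto intro!: mult_pos_pos w_pos simp: normal_density_pos)

lemma post_bound:
  assumes "\<And>j. j \<in> {1..n} \<Longrightarrow> \<bar>y j\<bar> \<le> R"
  shows "\<bar>post n w y z\<bar> \<le> R"
proof -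
  have "\<bar>\<Sum>j=1..n. w j * y j * std_normal_density (z - y j)\<bar>
      \<le> (\<Sum>j=1..n. R * (w j * std_normal_density (z - y j)))"
  proof (rule order_trans[OF sum_abs sum_mono])
    fix j assume j: "j \<in> {1..n}"
    have "\<bar>w j * y j * std_normal_density (z - y j)\<bar> = \<bar>y j\<bar> * (w j * std_normal_density (z - y j))"
      using w_pos[OF j] by (simp add: abs_mult)
    also have "\<dots> \<le> R * (w j * std_normal_density (z - y j))"
      using w_pos[OF j] assms[OF j] by (intro mult_right_mono) auto
    finally show "\<bar>w j * y j * std_normal_density (z - y j)\<bar> \<le> \<dots>" .
  qed
  then show ?thesis
    using output_density_pos[of z]
    by (simp add: post_def abs_divide divide_le_eq flip: sum_distrib_left)
qed

lemma post_bounded: obtains R where "\<And>j. j \<in> {1..n} \<Longrightarrow> \<bar>y j\<bar> \<le> R" "\<And>z. \<bar>post n w y z\<bar> \<le> R"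
proof -
  have "\<bar>y j\<bar> \<le> (\<Sum>j=1..n. \<bar>y j\<bar>)" if "j \<in> {1..n}" for j
    using that by (intro member_le_sum) auto
  with post_bound that show thesis by blast
qed

text \<open>The inequality holds under the integral, for each output \<open>z\<close> separately.
  With masses \<open>w j * std_normal_density (z - y j)\<close> the value
  \<open>post n w y z\<close> is the weighted mean of the levels, and the second moment about any
  other point exceeds the one about the mean by the squared distance times the total mass; the cross
  term vanishes.\<close>

lemma psi_post_optimal:
  assumes [measurable]: "m \<in> borel_measurable borel" and m: "\<And>z. \<bar>m z\<bar> \<le> R"
  shows "(\<Sum>j=1..n. w j * psi (post n w y) (y j)) \<le> (\<Sum>j=1..n. w j * psi m (y j))"
proof -
  obtain R' where R': "\<And>z. \<bar>post n w y z\<bar> \<le> R'" using post_bounded by metis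
  have eq: "(\<Sum>j=1..n. w j * psi m (y j))
        = (\<integral>z. (\<Sum>j=1..n. w j * ((y j - m z)\<^sup>2 * std_normal_density (z - y j))) \<partial>lborel)"
      and int: "integrable lborel (\<lambda>z. \<Sum>j=1..n. w j * ((y j - m z)\<^sup>2 * std_normal_density (z - y j)))"
    if [measurable]: "m \<in> borel_measurable borel" and m: "\<And>z. \<bar>m z\<bar> \<le> R" for m R
    using psi_integral[OF that] by (simp_all add: Bochner_Integration.integral_sum)
  show ?thesis
    unfolding eq[OF assms] eq[OF post_measurable R']
  proof (rule integral_mono[OF int[OF post_measurable R'] int[OF assms]])
    fix z
    let ?p = "\<lambda>j. w j * std_normal_density (z - y j)" and ?c = "post n w y z"
    have "(\<Sum>j=1..n. w j * ((y j - m z)\<^sup>2 * std_normal_density (z - y j)))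
        = (\<Sum>j=1..n. ?p j * (y j - ?c)\<^sup>2) + 2 * (?c - m z) * ((\<Sum>j=1..n. w j * y j * std_normal_density (z - y j)) - ?c * (\<Sum>j=1..n. ?p j))
          + (?c - m z)\<^sup>2 * (\<Sum>j=1..n. ?p j)"
      unfolding sum_distrib_left sum.distrib[symmetric] sum_subtractf[symmetric]
      by (intro sum.cong) (auto simp: power2_eq_square algebra_simps)
    moreover have "(\<Sum>j=1..n. w j * y j * std_normal_density (z - y j)) = ?c * (\<Sum>j=1..n. ?p j)"
      using output_density_pos[of z] by (simp add: post_def)
    ultimately show "(\<Sum>j=1..n. w j * ((y j - ?c)\<^sup>2 * std_normal_density (z - y j)))
        \<le> (\<Sum>j=1..n. w j * ((y j - m z)\<^sup>2 * std_normal_density (z - y j)))"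
      using output_density_pos[of z] by (simp add: mult_ac)
  qed
qed

section \<open>Expectations over the channel and identification of the conditional mean\<close>

abbreviation "C \<equiv> channel (atoms n w y)"

lemma prob_space_atoms: "prob_space (atoms n w y)"
proof -
  have "prob_space (point_measure {1..n} (\<lambda>j. ennreal (w j)))"
  proof (rule prob_space_point_measure)
    have "(\<Sum>j=1..n. ennreal (w j)) = ennreal (\<Sum>j=1..n. w j)"
      using w_pos by (intro sum_ennreal) (auto intro: less_imp_le)
    then show "(\<Sum>j=1..n. ennreal (w j)) = 1" using w_sum by simp
  qed auto
  then show ?thesis
    unfolding atoms_def by (rule prob_space.prob_space_distr) (simp add: measurable_def space_point_measure sets_point_measure)
qed

lemma sets_atoms [measurable_cong, simp]: "sets (atoms n w y) = sets borel"
  by (simp add: atoms_def)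

lemma space_atoms [simp]: "space (atoms n w y) = UNIV"
  by (simp add: atoms_def)

sublocale noise: prob_space "gaussian 1"
  by (rule prob_space_gaussian) simp

sublocale input: prob_space "atoms n w y"
  by (rule prob_space_atoms)

sublocale pair_prob_space "atoms n w y" "gaussian 1" ..

lemma sets_channel [measurable_cong]: "sets C = sets (borel \<Otimes>\<^sub>M borel)"
  unfolding channel_def by (intro sets_pair_measure_cong) simp_all

lemma prob_space_channel: "prob_space C"
  unfolding channel_def by (rule P.prob_space_axioms)

lemma space_channel [simp]: "space C = UNIV"
  by (simp add: channel_def space_pair_measure gaussian_def)

lemma AE_input: "AE x in atoms n w y. x \<in> y ` {1..n}"
proof -
  have "y ` {1..n} \<in> sets borel" by (intro borel_closed finite_imp_closed) simp
  then show ?thesis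
    unfolding atoms_def
    by (subst AE_distr_iff)
       (simp_all add: AE_point_measure measurable_def space_point_measure sets_point_measure)
qed

text \<open>Boundedness is demanded only at the levels, because the input almost surely is one of
  them. This admits functions such as \<open>fst\<close> that are unbounded on the whole
  plane.\<close>

lemma channel_integral:
  assumes h[measurable]: "h \<in> borel_measurable (borel \<Otimes>\<^sub>M borel)"
    and bound: "\<And>j x. j \<in> {1..n} \<Longrightarrow> \<bar>h (y j, x)\<bar> \<le> B"
  shows "integrable C h"
    and "integral\<^sup>L C h = (\<Sum>j=1..n. w j * (\<integral>x. h (y j, x) * std_normal_density x \<partial>lborel))"
proof -
  have "AE \<omega> in C. norm (h \<omega>) \<le> B"
    unfolding channel_def
  proof (rule AE_pair_measure)
    show "AE x in atoms n w y. AE z in gaussian 1. norm (h (x, z)) \<le> B"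
      using AE_input
    proof eventually_elim
      case (elim x)
      then show ?case by (intro AE_I2) (use bound in auto)
    qed
  qed measurable
  then show int: "integrable C h"
    by (intro finite_measure.integrable_const_bound[of C])
       (auto intro: prob_space.finite_measure prob_space_channel)
  have [measurable]: "y \<in> point_measure {1..n} (\<lambda>j. ennreal (w j)) \<rightarrow>\<^sub>M borel"
    by (simp add: measurable_def space_point_measure sets_point_measure)
  have "integral\<^sup>L C h = (\<integral>x. (\<integral>z. h (x, z) \<partial>gaussian 1) \<partial>atoms n w y)"
    using int unfolding channel_def by (rule integral_fst'[symmetric])
  also have "\<dots> = (\<integral>j. (\<integral>z. h (y j, z) \<partial>gaussian 1) \<partial>point_measure {1..n} (\<lambda>j. ennreal (w j)))"
    unfolding atoms_def by (rule integral_distr) measurable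
  also have "\<dots> = (\<Sum>j=1..n. w j * (\<integral>z. h (y j, z) \<partial>gaussian 1))"
    by (subst lebesgue_integral_point_measure_finite) (simp_all add: less_imp_le w_pos)
  also have "\<dots> = (\<Sum>j=1..n. w j * (\<integral>x. h (y j, x) * std_normal_density x \<partial>lborel))"
    unfolding gaussian_def by (subst integral_density) (auto simp: mult.commute)
  finally show "integral\<^sup>L C h = \<dots>" .
qed

text \<open>Substituting \<open>z = y j + x\<close> turns the noise into the output, so an
  expectation over the channel becomes a mixture of integrals against translated Gaussians, the form
  in which \<open>psi\<close> is written.\<close>

lemma channel_output_integral:
  assumes k[measurable]: "k \<in> borel_measurable (borel \<Otimes>\<^sub>M borel)"
    and bound: "\<And>j z. j \<in> {1..n} \<Longrightarrow> \<bar>k (y j, z)\<bar> \<le> B"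
  shows "integrable C (\<lambda>\<omega>. k (fst \<omega>, fst \<omega> + snd \<omega>))"
    and "(\<integral>\<omega>. k (fst \<omega>, fst \<omega> + snd \<omega>) \<partial>C)
      = (\<Sum>j=1..n. w j * (\<integral>z. k (y j, z) * std_normal_density (z - y j) \<partial>lborel))"
proof -
  have m: "(\<lambda>\<omega>. k (fst \<omega>, fst \<omega> + snd \<omega>)) \<in> borel_measurable (borel \<Otimes>\<^sub>M borel)"
    by measurable
  show "integrable C (\<lambda>\<omega>. k (fst \<omega>, fst \<omega> + snd \<omega>))"
    using bound by (intro channel_integral(1)[OF m]) auto
  have "(\<integral>\<omega>. k (fst \<omega>, fst \<omega> + snd \<omega>) \<partial>C)
      = (\<Sum>j=1..n. w j * (\<integral>x. k (y j, y j + x) * std_normal_density x \<partial>lborel))"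
    using bound by (subst channel_integral(2)[OF m]) auto
  also have "\<dots> = (\<Sum>j=1..n. w j * (\<integral>z. k (y j, z) * std_normal_density (z - y j) \<partial>lborel))"
    using lborel_integral_real_affine[where c = 1 and f = "\<lambda>z. k (y j, z) * std_normal_density (z - y j)" and t = "y j" for j]
    by simp
  finally show "(\<integral>\<omega>. k (fst \<omega>, fst \<omega> + snd \<omega>) \<partial>C) = \<dots>" .
qed

text \<open>Null sets of the output law are Lebesgue null because a single input of positive weight
  already gives an everywhere positive density. This transfers the almost sure characterization of
  \<open>cond_exp_at\<close> to Lebesgue measure.\<close>

lemma AE_output_imp_AE_lborel:
  assumes [measurable]: "Measurable.pred borel P"
    and ae: "AE \<omega> in C. P (fst \<omega> + snd \<omega>)"
  shows "AE z in lborel. P z"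
proof -
  let ?k = "\<lambda>\<omega>::real \<times> real. indicator {z. \<not> P z} (snd \<omega>) :: real"
  have [measurable]: "?k \<in> borel_measurable (borel \<Otimes>\<^sub>M borel)" by measurable
  have bound: "\<bar>?k (y j, z)\<bar> \<le> 1" for j z by (simp add: indicator_def)
  have int: "integrable lborel (\<lambda>z. ?k (y j, z) * std_normal_density (z - y j))" for j
    by (rule smooth_integrable[of _ 1]) (auto simp: indicator_def)
  have "0 = (\<integral>\<omega>. ?k (fst \<omega>, fst \<omega> + snd \<omega>) \<partial>C)"
    using ae by (intro integral_eq_zero_AE[symmetric]) (auto elim!: eventually_mono simp: indicator_def)
  also have "\<dots> = (\<Sum>j=1..n. w j * (\<integral>z. ?k (y j, z) * std_normal_density (z - y j) \<partial>lborel))"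
    using bound by (intro channel_output_integral) auto
  finally have "(\<Sum>j=1..n. w j * (\<integral>z. ?k (y j, z) * std_normal_density (z - y j) \<partial>lborel)) = 0"
    by (rule sym)
  moreover have "w j * (\<integral>z. ?k (y j, z) * std_normal_density (z - y j) \<partial>lborel) \<ge> 0" if "j \<in> {1..n}" for j
    using w_pos[OF that] by (intro mult_nonneg_nonneg integral_nonneg_AE) auto
  ultimately have "w 1 * (\<integral>z. ?k (y 1, z) * std_normal_density (z - y 1) \<partial>lborel) = 0"
    using n_pos by (subst (asm) sum_nonneg_eq_0_iff) auto
  then have "(\<integral>z. ?k (y 1, z) * std_normal_density (z - y 1) \<partial>lborel) = 0"
    using w_pos[OF n_pos] by simp
  then have "AE z in lborel. ?k (y 1, z) * std_normal_density (z - y 1) = 0"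
    by (subst (asm) integral_nonneg_eq_0_iff_AE[OF int]) auto
  then show ?thesis
    by eventually_elim (auto simp: indicator_def normal_density_pos less_imp_neq[symmetric] split: if_splits)
qed

abbreviation "obs \<equiv> \<lambda>\<omega>::real \<times> real. fst \<omega> + snd \<omega>"

lemma subalgebra_output: "subalgebra C (sigma_gen C obs)"
  unfolding subalgebra_def
  by (auto simp: sets_vimage_algebra2 intro!: measurable_sets[of obs C borel, simplified])

lemma finite_measure_subalgebra_output: "finite_measure_subalgebra C (sigma_gen C obs)"
  using prob_space.finite_measure[OF prob_space_channel] subalgebra_output
  by (simp add: finite_measure_subalgebra_def finite_measure_subalgebra_axioms_def)

text \<open>By the defining property of conditional expectation it suffices to compare integrals
  over output events. Both reduce to Lebesgue integrals over the event, of the numerator of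
  \<open>post\<close> on one side and of \<open>post\<close> times its denominator on the
  other.\<close>

lemma real_cond_exp_input:
  "AE \<omega> in C. real_cond_exp C (sigma_gen C obs) fst \<omega> = post n w y (obs \<omega>)"
proof -
  interpret sub: finite_measure_subalgebra C "sigma_gen C obs"
    by (rule finite_measure_subalgebra_output)
  obtain R where R: "\<And>j. j \<in> {1..n} \<Longrightarrow> \<bar>y j\<bar> \<le> R" "\<And>z. \<bar>post n w y z\<bar> \<le> R"
    using post_bounded by metis
  show ?thesis
  proof (rule sub.real_cond_exp_charact)
    show "integrable C fst"
      using R by (intro channel_integral(1)) auto
    show "integrable C (\<lambda>\<omega>. post n w y (obs \<omega>))"
      using R by (intro channel_output_integral(1)[of "\<lambda>\<omega>. post n w y (snd \<omega>)", simplified]) auto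
    show "(\<lambda>\<omega>. post n w y (obs \<omega>)) \<in> borel_measurable (sigma_gen C obs)"
      by (rule measurable_compose[OF measurable_vimage_algebra1 post_measurable]) auto
    fix A assume "A \<in> sets (sigma_gen C obs)"
    then obtain B where B[measurable]: "B \<in> sets borel" and A: "A = obs -` B"
      by (auto simp: sets_vimage_algebra2)
    let ?i = "indicator B :: real \<Rightarrow> real"
    have ind: "indicator A \<omega> = ?i (fst \<omega> + snd \<omega>)" for \<omega> :: "real \<times> real"
      by (simp add: A indicator_def)
    have int: "integrable lborel (\<lambda>z. ?i z * f z * std_normal_density (z - y j))"
      if [measurable]: "f \<in> borel_measurable borel" and "\<And>z. \<bar>f z\<bar> \<le> R" for f R j
    proof (rule smooth_integrable[of _ R])
      have "0 \<le> R" using that(2)[of 0] by linarith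
      then show "\<bar>?i z * f z\<bar> \<le> R" for z
        using that(2) by (simp add: indicator_def)
    qed measurable
    have "(\<integral>\<omega>\<in>A. fst \<omega> \<partial>C) = (\<integral>\<omega>. (\<lambda>(x, z). ?i z * x) (fst \<omega>, fst \<omega> + snd \<omega>) \<partial>C)"
      by (simp add: set_lebesgue_integral_def ind)
    also have "\<dots> = (\<Sum>j=1..n. w j * (\<integral>z. ?i z * y j * std_normal_density (z - y j) \<partial>lborel))"
      using R(1) by (subst channel_output_integral(2)[of _ R])
        (auto simp: indicator_def intro: order_trans[OF abs_ge_zero])
    also have "\<dots> = (\<integral>z. ?i z * (\<Sum>j=1..n. w j * y j * std_normal_density (z - y j)) \<partial>lborel)"
    proof -
      have "(\<Sum>j=1..n. w j * (\<integral>z. ?i z * y j * std_normal_density (z - y j) \<partial>lborel))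
        = (\<integral>z. (\<Sum>j=1..n. w j * (?i z * y j * std_normal_density (z - y j))) \<partial>lborel)"
        using int[of "\<lambda>_. c" "\<bar>c\<bar>" for c] by (simp add: Bochner_Integration.integral_sum)
      then show ?thesis by (simp add: sum_distrib_left mult_ac)
    qed
    \<comment> \<open>Bayes' formula enters here: the output density is positive, so multiplying
      \<open>post\<close> by it restores the numerator.\<close>
    also have "\<dots> = (\<integral>z. ?i z * (post n w y z * (\<Sum>j=1..n. w j * std_normal_density (z - y j))) \<partial>lborel)"
      using output_density_pos by (simp add: post_def less_imp_neq[symmetric])
    also have "\<dots> = (\<Sum>j=1..n. w j * (\<integral>z. ?i z * post n w y z * std_normal_density (z - y j) \<partial>lborel))"
    proof -
      have "(\<Sum>j=1..n. w j * (\<integral>z. ?i z * post n w y z * std_normal_density (z - y j) \<partial>lborel))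
        = (\<integral>z. (\<Sum>j=1..n. w j * (?i z * post n w y z * std_normal_density (z - y j))) \<partial>lborel)"
        using int[OF post_measurable R(2)] by (simp add: Bochner_Integration.integral_sum)
      then show ?thesis by (simp add: sum_distrib_left mult_ac)
    qed
    also have "\<dots> = (\<integral>\<omega>. (\<lambda>(x, z). ?i z * post n w y z) (fst \<omega>, fst \<omega> + snd \<omega>) \<partial>C)"
      using R(2) by (subst channel_output_integral(2)[of _ R])
        (auto simp: indicator_def intro: order_trans[OF abs_ge_zero])
    also have "\<dots> = (\<integral>\<omega>\<in>A. post n w y (obs \<omega>) \<partial>C)"
      by (simp add: set_lebesgue_integral_def ind)
    finally show "(\<integral>\<omega>\<in>A. fst \<omega> \<partial>C) = (\<integral>\<omega>\<in>A. post n w y (obs \<omega>) \<partial>C)" .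
  qed
qed

text \<open>Integrating the outer conditional expectation removes it and leaves the mean squared
  error of the conditional mean, which \<open>post\<close> represents almost surely.\<close>

lemma mmse_atoms: "mmse (atoms n w y) = (\<Sum>j=1..n. w j * psi (post n w y) (y j))"
proof -
  interpret sub: finite_measure_subalgebra C "sigma_gen C obs"
    by (rule finite_measure_subalgebra_output)
  obtain R where R: "\<And>j. j \<in> {1..n} \<Longrightarrow> \<bar>y j\<bar> \<le> R" "\<And>z. \<bar>post n w y z\<bar> \<le> R"
    using post_bounded by metis
  let ?E = "real_cond_exp C (sigma_gen C obs) fst"
  let ?k = "\<lambda>\<omega>. (fst \<omega> - post n w y (snd \<omega>))\<^sup>2"
  have [measurable]: "?E \<in> borel_measurable C" by simp
  have k: "?k \<in> borel_measurable (borel \<Otimes>\<^sub>M borel)" by measurable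
  have bound: "\<bar>?k (y j, z)\<bar> \<le> (2 * R)\<^sup>2" if "j \<in> {1..n}" for j z
    using R(1)[OF that] R(2)[of z] unfolding fst_conv snd_conv by (intro abs_le_imp_power2_le) linarith
  note k_int = channel_output_integral[OF k bound, simplified]
  have ae: "AE \<omega> in C. (fst \<omega> - ?E \<omega>)\<^sup>2 = (fst \<omega> - post n w y (obs \<omega>))\<^sup>2"
    using real_cond_exp_input by eventually_elim simp
  have int: "integrable C (\<lambda>\<omega>. (fst \<omega> - ?E \<omega>)\<^sup>2)"
    using k_int(1) ae by (subst integrable_cong_AE) auto
  have "mmse (atoms n w y) = (\<integral>\<omega>. (fst \<omega> - ?E \<omega>)\<^sup>2 \<partial>C)"
    unfolding mmse_def cond_var_def using sub.real_cond_exp_int(2)[OF int] .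
  also have "\<dots> = (\<integral>\<omega>. (fst \<omega> - post n w y (obs \<omega>))\<^sup>2 \<partial>C)"
    using ae by (intro integral_cong_AE) auto
  also have "\<dots> = (\<Sum>j=1..n. w j * psi (post n w y) (y j))"
    using k_int(2) by (simp add: psi_integral(2)[OF post_measurable R(2)])
  finally show ?thesis .
qed

text \<open>The function \<open>post\<close> witnesses that the choice in \<open>cond_exp_at\<close>
  is from a nonempty set. The chosen version then agrees with \<open>post\<close> along the output,
  hence Lebesgue almost everywhere.\<close>

lemma post_mean_atoms:
  "post_mean (atoms n w y) \<in> borel_measurable borel"
  "AE z in lborel. post_mean (atoms n w y) z = post n w y z"
proof -
  let ?P = "\<lambda>g. g \<in> borel_measurable borel \<and> (AE \<omega> in C. g (obs \<omega>) = real_cond_exp C (sigma_gen C obs) fst \<omega>)"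
  have "?P (post n w y)"
    using real_cond_exp_input by (auto elim!: eventually_mono)
  then have "?P (SOME g. ?P g)" by (rule someI[where P = ?P])
  moreover have "(SOME g. ?P g) = post_mean (atoms n w y)"
    by (simp only: post_mean_def cond_exp_at_def)
  ultimately have P: "?P (post_mean (atoms n w y))" by (simp only:)
  then show m[measurable]: "post_mean (atoms n w y) \<in> borel_measurable borel" by simp
  have "AE \<omega> in C. post_mean (atoms n w y) (obs \<omega>) = post n w y (obs \<omega>)"
    using conjunct2[OF P] real_cond_exp_input by eventually_elim simp
  then show "AE z in lborel. post_mean (atoms n w y) z = post n w y z"
    by (intro AE_output_imp_AE_lborel) measurable
qed

lemma Psi_atoms: "Psi (atoms n w y) = psi (post n w y)"
proof -
  note [measurable] = post_mean_atoms(1)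
  have "a_fun (atoms n w y) x = smooth (post n w y) x"
    "b_fun (atoms n w y) x = smooth (\<lambda>z. (post n w y z)\<^sup>2) x" for x
    unfolding a_fun_def b_fun_def smooth_def using post_mean_atoms(2)
    by (auto intro!: integral_cong_AE elim!: eventually_mono)
  then show ?thesis by (auto simp: Psi_def psi_def fun_eq_iff)
qed

end

section \<open>Derivatives of the minimum mean squared error\<close>

text \<open>The derivative of \<open>psi m\<close> at \<open>y\<close> with \<open>m\<close> frozen,
  by the product rule; the integrals are the derivatives of the two smoothed functions.\<close>

definition dpsi :: "(real \<Rightarrow> real) \<Rightarrow> real \<Rightarrow> real" where
  "dpsi m y = 2 * y - (2 * smooth m y + 2 * y * (\<integral>z. m z * ((z - y) * std_normal_density (z - y)) \<partial>lborel))
     + (\<integral>z. (m z)\<^sup>2 * ((z - y) * std_normal_density (z - y)) \<partial>lborel)"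

text \<open>The square and the factor \<open>y\<close> in the mixed term contribute
  \<open>2 * R\<close> each. The Lipschitz bounds for the smoothed functions contribute
  \<open>4 * exp 4 * R\<^sup>2\<close> and \<open>2 * exp 4 * R\<^sup>2\<close>.\<close>

definition psi_lip :: "real \<Rightarrow> real" where
  "psi_lip R = 4 * R + 6 * exp 4 * R\<^sup>2"

lemma psi_lipschitz:
  assumes [measurable]: "m \<in> borel_measurable borel" and m: "\<And>z. \<bar>m z\<bar> \<le> R"
    and y: "\<bar>y\<bar> \<le> R" "\<bar>y'\<bar> \<le> R"
  shows "\<bar>psi m y - psi m y'\<bar> \<le> psi_lip R * \<bar>y - y'\<bar>"
proof -
  let ?d = "\<bar>y - y'\<bar>" and ?B = "smooth (\<lambda>z. (m z)\<^sup>2)"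
  have "psi m y - psi m y' = (y - y') * (y + y') - 2 * ((y - y') * smooth m y)
      - 2 * (y' * (smooth m y - smooth m y')) + (?B y - ?B y')"
    by (simp add: psi_def power2_eq_square algebra_simps)
  then have "\<bar>psi m y - psi m y'\<bar> \<le> \<bar>(y - y') * (y + y')\<bar> + 2 * \<bar>(y - y') * smooth m y\<bar>
      + 2 * \<bar>y' * (smooth m y - smooth m y')\<bar> + \<bar>?B y - ?B y'\<bar>"
    by linarith
  also have "\<dots> \<le> ?d * (2 * R) + 2 * (?d * R) + 2 * (R * (2 * exp 4 * R * ?d)) + 2 * exp 4 * R\<^sup>2 * ?d"
  proof (intro add_mono mult_left_mono)
    show "\<bar>(y - y') * (y + y')\<bar> \<le> ?d * (2 * R)"
      unfolding abs_mult using y by (intro mult_left_mono) auto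
    show "\<bar>(y - y') * smooth m y\<bar> \<le> ?d * R"
      unfolding abs_mult using smooth_bound[OF assms(1) m] by (intro mult_left_mono) auto
    show "\<bar>y' * (smooth m y - smooth m y')\<bar> \<le> R * (2 * exp 4 * R * ?d)"
      unfolding abs_mult using y smooth_lipschitz[OF assms(1) m] by (intro mult_mono) auto
    show "\<bar>?B y - ?B y'\<bar> \<le> 2 * exp 4 * R\<^sup>2 * ?d"
      by (intro smooth_lipschitz abs_le_imp_power2_le m) measurable
  qed auto
  also have "\<dots> = psi_lip R * ?d"
    by (simp add: psi_lip_def power2_eq_square algebra_simps)
  finally show ?thesis .
qed

lemma tendsto_psi:
  fixes m :: "real \<Rightarrow> real \<Rightarrow> real"
  assumes [measurable]: "\<And>t. m t \<in> borel_measurable borel" "m0 \<in> borel_measurable borel"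
    and bound: "\<forall>\<^sub>F t in at a. \<forall>z. \<bar>m t z\<bar> \<le> R"
    and lim: "\<And>z. ((\<lambda>t. m t z) \<longlongrightarrow> m0 z) (at a)"
  shows "((\<lambda>t. psi (m t) y) \<longlongrightarrow> psi m0 y) (at a)"
proof -
  have "\<forall>\<^sub>F t in at a. \<forall>z. \<bar>(m t z)\<^sup>2\<bar> \<le> R\<^sup>2"
    using bound by eventually_elim (blast intro: abs_le_imp_power2_le)
  then have "((\<lambda>t. smooth (\<lambda>z. (m t z)\<^sup>2) y) \<longlongrightarrow> smooth (\<lambda>z. (m0 z)\<^sup>2) y) (at a)"
    by (intro tendsto_smooth tendsto_power lim) measurable
  moreover have "((\<lambda>t. smooth (m t) y) \<longlongrightarrow> smooth m0 y) (at a)"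
    by (intro tendsto_smooth[OF _ _ bound lim]) measurable
  ultimately show ?thesis
    unfolding psi_def by (intro tendsto_intros)
qed

lemma tendsto_psi_quotient:
  fixes m :: "real \<Rightarrow> real \<Rightarrow> real"
  assumes [measurable]: "\<And>t. m t \<in> borel_measurable borel" "m0 \<in> borel_measurable borel"
    and bound: "\<forall>\<^sub>F t in at a. \<forall>z. \<bar>m t z\<bar> \<le> R"
    and lim: "\<And>z. ((\<lambda>t. m t z) \<longlongrightarrow> m0 z) (at a)"
  shows "((\<lambda>t. (psi (m t) t - psi (m t) a) / (t - a)) \<longlongrightarrow> dpsi m0 a) (at a)"
proof -
  let ?A = "\<lambda>t. smooth (m t)" and ?B = "\<lambda>t. smooth (\<lambda>z. (m t z)\<^sup>2)"
  have bound2: "\<forall>\<^sub>F t in at a. \<forall>z. \<bar>(m t z)\<^sup>2\<bar> \<le> R\<^sup>2"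
    using bound by eventually_elim (blast intro: abs_le_imp_power2_le)
  have A: "((\<lambda>t. ?A t a) \<longlongrightarrow> smooth m0 a) (at a)"
    by (intro tendsto_smooth[OF _ _ bound lim]) measurable
  have qA: "((\<lambda>t. (?A t t - ?A t a) / (t - a))
      \<longlongrightarrow> (\<integral>z. m0 z * ((z - a) * std_normal_density (z - a)) \<partial>lborel)) (at a)"
    by (intro tendsto_smooth_quotient[OF _ _ bound lim]) measurable
  have qB: "((\<lambda>t. (?B t t - ?B t a) / (t - a))
      \<longlongrightarrow> (\<integral>z. (m0 z)\<^sup>2 * ((z - a) * std_normal_density (z - a)) \<partial>lborel)) (at a)"
    by (intro tendsto_smooth_quotient[OF _ _ bound2] tendsto_power lim) measurable
  \<comment> \<open>A discrete product rule: the increment of \<open>t * A t\<close> is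
    \<open>(t - a) * A a\<close> plus \<open>t\<close> times the increment of \<open>A\<close>,
    where \<open>A\<close> is smoothed with the estimator \<open>m t\<close> held fixed.\<close>
  have "((\<lambda>t. (t + a) - (2 * ?A t a + 2 * t * ((?A t t - ?A t a) / (t - a))) + (?B t t - ?B t a) / (t - a))
      \<longlongrightarrow> (a + a) - (2 * smooth m0 a + 2 * a * (\<integral>z. m0 z * ((z - a) * std_normal_density (z - a)) \<partial>lborel))
        + (\<integral>z. (m0 z)\<^sup>2 * ((z - a) * std_normal_density (z - a)) \<partial>lborel)) (at a)"
    by (intro tendsto_intros A qA qB)
  then have "((\<lambda>t. (t + a) - (2 * ?A t a + 2 * t * ((?A t t - ?A t a) / (t - a))) + (?B t t - ?B t a) / (t - a))
      \<longlongrightarrow> dpsi m0 a) (at a)"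
    by (simp add: dpsi_def)
  moreover have "\<forall>\<^sub>F t in at a. (t + a) - (2 * ?A t a + 2 * t * ((?A t t - ?A t a) / (t - a))) + (?B t t - ?B t a) / (t - a)
      = (psi (m t) t - psi (m t) a) / (t - a)"
    unfolding eventually_at_filter
    by (auto intro!: always_eventually simp: psi_def divide_simps power2_eq_square) (simp add: algebra_simps)
  ultimately show ?thesis by (rule Lim_transform_eventually)
qed

text \<open>A derivative is bounded by a Lipschitz constant for its difference quotients. The radius
  \<open>R + 1\<close> leaves room for the points within distance 1 of \<open>y\<close>.\<close>

lemma dpsi_bound:
  assumes [measurable]: "m \<in> borel_measurable borel" and m: "\<And>z. \<bar>m z\<bar> \<le> R" and y: "\<bar>y\<bar> \<le> R"
  shows "\<bar>dpsi m y\<bar> \<le> psi_lip (R + 1)"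
proof (rule tendsto_upperbound)
  show "((\<lambda>t. \<bar>(psi m t - psi m y) / (t - y)\<bar>) \<longlongrightarrow> \<bar>dpsi m y\<bar>) (at y)"
    by (intro tendsto_rabs tendsto_psi_quotient[where m = "\<lambda>_. m" and R = R])
       (auto intro: m always_eventually)
  have "\<forall>\<^sub>F t in at y. \<bar>t - y\<bar> \<le> 1"
    using eventually_at_ball[of 1 y UNIV] by (auto simp: dist_real_def elim!: eventually_mono)
  moreover have "\<forall>\<^sub>F t in at y. t \<noteq> y"
    by (simp add: eventually_at_filter)
  ultimately show "\<forall>\<^sub>F t in at y. \<bar>(psi m t - psi m y) / (t - y)\<bar> \<le> psi_lip (R + 1)"
  proof eventually_elim
    case (elim t)
    have m1: "\<bar>m z\<bar> \<le> R + 1" for z using m[of z] by linarith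
    have "\<bar>psi m t - psi m y\<bar> \<le> psi_lip (R + 1) * \<bar>t - y\<bar>"
      using elim y by (intro psi_lipschitz[OF assms(1) m1]) auto
    then show ?case using elim by (simp add: divide_le_eq)
  qed
qed simp

lemma tendsto_post:
  assumes "finite_input n w0"
    and w: "\<And>j. j \<in> {1..n} \<Longrightarrow> ((\<lambda>t. w t j) \<longlongrightarrow> w0 j) F"
    and y: "\<And>j. j \<in> {1..n} \<Longrightarrow> ((\<lambda>t. y t j) \<longlongrightarrow> y0 j) F"
  shows "((\<lambda>t. post n (w t) (y t) z) \<longlongrightarrow> post n w0 y0 z) F"
proof -
  interpret finite_input n w0 y0 by fact
  have "((\<lambda>t. std_normal_density (z - y t j)) \<longlongrightarrow> std_normal_density (z - y0 j)) F" if "j \<in> {1..n}" for j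
    unfolding std_normal_density_def by (intro tendsto_intros y that) simp
  then show ?thesis
    unfolding post_def using output_density_pos[of z]
    by (intro tendsto_divide tendsto_sum tendsto_mult w y) auto
qed

context finite_input
begin

lemma mmse_slice_has_real_derivative:
  assumes i: "i \<in> {1..n}"
  shows "(mmse_slice n w y i has_real_derivative w i * dpsi (post n w y) (y i)) (at (y i))"
proof -
  let ?m = "\<lambda>t. post n w (y(i := t))"
  \<comment> \<open>\<open>?F s t\<close> is the risk at the levels with \<open>i\<close>-th entry
    \<open>t\<close> of the estimator tuned to the entry \<open>s\<close>; on the diagonal it is the
    MMSE.\<close>
  let ?F = "\<lambda>s t. \<Sum>j=1..n. w j * psi (?m s) ((y(i := t)) j)"
  have upd: "finite_input n w"
    using weights by unfold_locales
  have U: "mmse_slice n w y i t = ?F t t" for t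
    unfolding mmse_slice_def by (rule finite_input.mmse_atoms[OF upd])
  have opt: "mmse_slice n w y i t \<le> ?F s t" for s t
  proof -
    obtain R where "\<And>z. \<bar>?m s z\<bar> \<le> R" using finite_input.post_bounded[OF upd] by metis
    then show ?thesis
      unfolding U by (intro finite_input.psi_post_optimal[OF upd]) measurable
  qed
  have inc: "?F s t - ?F s (y i) = w i * (psi (?m s) t - psi (?m s) (y i))" for s t
  proof -
    have "?F s t - ?F s (y i) = (\<Sum>j=1..n. if j = i then w i * (psi (?m s) t - psi (?m s) (y i)) else 0)"
      unfolding sum_subtractf[symmetric] by (intro sum.cong) (auto simp: algebra_simps)
    then show ?thesis using i by simp
  qed
  obtain R where R: "\<And>j. j \<in> {1..n} \<Longrightarrow> \<bar>y j\<bar> \<le> R" using post_bounded by metis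
  have "\<forall>\<^sub>F t in at (y i). \<bar>t - y i\<bar> \<le> 1"
    using eventually_at_ball[of 1 "y i" UNIV] by (auto simp: dist_real_def elim!: eventually_mono)
  \<comment> \<open>Moving one level by at most 1 keeps all levels within \<open>R + 1\<close>,
    which gives the posterior means a common bound.\<close>
  then have bound: "\<forall>\<^sub>F t in at (y i). \<forall>z. \<bar>?m t z\<bar> \<le> R + 1"
  proof eventually_elim
    case (elim t)
    have "\<bar>(y(i := t)) j\<bar> \<le> R + 1" if "j \<in> {1..n}" for j
      using elim R[OF that] R[OF i] by (auto simp: fun_upd_def)
    then show ?case using finite_input.post_bound[OF upd] by blast
  qed
  have lim: "((\<lambda>t. ?m t z) \<longlongrightarrow> post n w y z) (at (y i))" for z
  proof (intro tendsto_post finite_input_axioms)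
    show "((\<lambda>t. (y(i := t)) j) \<longlongrightarrow> y j) (at (y i))" for j
      by (cases "j = i") auto
  qed auto
  have q: "((\<lambda>t. (?F t t - ?F t (y i)) / (t - y i)) \<longlongrightarrow> w i * dpsi (post n w y) (y i)) (at (y i))"
    unfolding inc times_divide_eq_right[symmetric]
    by (intro tendsto_mult_left tendsto_psi_quotient[OF _ _ bound lim]) measurable
  have inc0: "?F (y i) t - ?F (y i) (y i) = w i * (psi (post n w y) t - psi (post n w y) (y i))" for t
    using inc[of "y i" t] by (simp only: fun_upd_triv)
  have "\<forall>z. \<bar>post n w y z\<bar> \<le> R" using post_bound[OF R] by blast
  then have "((\<lambda>t. (psi (post n w y) t - psi (post n w y) (y i)) / (t - y i)) \<longlongrightarrow> dpsi (post n w y) (y i)) (at (y i))"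
    by (intro tendsto_psi_quotient[where m = "\<lambda>_. post n w y" and R = R])
       (auto intro: always_eventually)
  then have q0: "((\<lambda>t. (?F (y i) t - ?F (y i) (y i)) / (t - y i)) \<longlongrightarrow> w i * dpsi (post n w y) (y i)) (at (y i))"
    unfolding inc0 times_divide_eq_right[symmetric] by (rule tendsto_mult_left)
  show ?thesis
  proof (rule has_real_derivative_envelope[where F = ?F])
    show "\<forall>\<^sub>F t in at (y i). mmse_slice n w y i t = ?F t t \<and> mmse_slice n w y i t \<le> ?F (y i) t
        \<and> mmse_slice n w y i (y i) \<le> ?F t (y i)"
      by (intro always_eventually allI conjI U opt)
  qed (fact U q q0)+
qed

text \<open>The factor \<open>w i\<close> is kept because \<open>level_correction\<close> divides by
  it; the quotient is then bounded in terms of \<open>R\<close> alone.\<close>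

lemma deriv_mmse_slice_bound:
  assumes i: "i \<in> {1..n}" and R: "\<And>j. j \<in> {1..n} \<Longrightarrow> \<bar>y j\<bar> \<le> R"
  shows "\<bar>deriv (mmse_slice n w y i) (y i)\<bar> \<le> w i * psi_lip (R + 1)"
proof -
  have "deriv (mmse_slice n w y i) (y i) = w i * dpsi (post n w y) (y i)"
    by (rule DERIV_imp_deriv[OF mmse_slice_has_real_derivative[OF i]])
  moreover have "\<bar>dpsi (post n w y) (y i)\<bar> \<le> psi_lip (R + 1)"
    using post_bound[OF R] R[OF i] by (intro dpsi_bound) auto
  ultimately show ?thesis
    using w_pos[OF i] by (simp add: abs_mult)
qed

end

text \<open>For a frozen estimator the risk is linear in the weights, so its quotient is a sum of
  weight quotients times \<open>psi\<close> at fixed levels. Only the convergence of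
  \<open>psi\<close> along the moving estimator is left to dominated convergence.\<close>

lemma mmse_weights_has_real_derivative:
  fixes w :: "real \<Rightarrow> nat \<Rightarrow> real"
  assumes w0: "prob_weights n (w t0)" and w: "\<forall>\<^sub>F t in at t0. prob_weights n (w t)"
    and w': "\<And>j. j \<in> {1..n} \<Longrightarrow> ((\<lambda>t. w t j) has_real_derivative w' j) (at t0)"
  shows "((\<lambda>t. mmse (atoms n (w t) y)) has_real_derivative
    (\<Sum>j=1..n. w' j * psi (post n (w t0) y) (y j))) (at t0)"
proof -
  let ?m = "\<lambda>t. post n (w t) y"
  let ?F = "\<lambda>s t. \<Sum>j=1..n. w t j * psi (?m s) (y j)"
  have fin: "finite_input n (w t)" if "prob_weights n (w t)" for t
    using that by unfold_locales
  have U: "mmse (atoms n (w t) y) = ?F t t" if "prob_weights n (w t)" for t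
    by (rule finite_input.mmse_atoms[OF fin[OF that]])
  obtain R where R: "\<And>j. j \<in> {1..n} \<Longrightarrow> \<bar>y j\<bar> \<le> R"
    using finite_input.post_bounded[OF fin[OF w0]] by metis
  have mR: "\<bar>?m t z\<bar> \<le> R" if "prob_weights n (w t)" for t z
    using finite_input.post_bound[OF fin[OF that] R] .
  have opt: "mmse (atoms n (w t) y) \<le> ?F s t" if "prob_weights n (w t)" "prob_weights n (w s)" for s t
    unfolding U[OF that(1)]
    using mR[OF that(2)] by (intro finite_input.psi_post_optimal[OF fin[OF that(1)]]) measurable
  have lim: "((\<lambda>t. ?m t z) \<longlongrightarrow> ?m t0 z) (at t0)" for z
    using DERIV_isCont[OF w'] by (intro tendsto_post fin[OF w0]) (auto simp: isCont_def)
  have bound: "\<forall>\<^sub>F t in at t0. \<forall>z. \<bar>?m t z\<bar> \<le> R"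
    using w by eventually_elim (blast intro: mR)
  have quot: "((\<lambda>t. (?F (s t) t - ?F (s t) t0) / (t - t0)) \<longlongrightarrow> (\<Sum>j=1..n. w' j * psi (?m t0) (y j))) (at t0)"
    if "\<And>j. ((\<lambda>t. psi (?m (s t)) (y j)) \<longlongrightarrow> psi (?m t0) (y j)) (at t0)" for s
  proof -
    have "(?F (s t) t - ?F (s t) t0) / (t - t0)
        = (\<Sum>j=1..n. ((w t j - w t0 j) / (t - t0)) * psi (?m (s t)) (y j))" for t
      by (simp add: sum_subtractf[symmetric] sum_divide_distrib left_diff_distrib)
    moreover have "((\<lambda>t. (w t j - w t0 j) / (t - t0)) \<longlongrightarrow> w' j) (at t0)" if "j \<in> {1..n}" for j
      using w'[OF that] by (simp add: has_field_derivative_iff)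
    ultimately show ?thesis
      by (simp only:) (intro tendsto_sum tendsto_mult that)
  qed
  show ?thesis
  proof (rule has_real_derivative_envelope[where F = ?F])
    show "\<forall>\<^sub>F t in at t0. mmse (atoms n (w t) y) = ?F t t \<and> mmse (atoms n (w t) y) \<le> ?F t0 t
        \<and> mmse (atoms n (w t0) y) \<le> ?F t t0"
      using w by eventually_elim (use U opt w0 in blast)
    show "((\<lambda>t. (?F t t - ?F t t0) / (t - t0)) \<longlongrightarrow> (\<Sum>j=1..n. w' j * psi (?m t0) (y j))) (at t0)"
      by (intro quot tendsto_psi[OF _ _ bound lim]) measurable
    show "((\<lambda>t. (?F t0 t - ?F t0 t0) / (t - t0)) \<longlongrightarrow> (\<Sum>j=1..n. w' j * psi (?m t0) (y j))) (at t0)"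
      by (intro quot tendsto_const)
  qed (rule U[OF w0])
qed

section \<open>Gaussian integrals over the bins\<close>

text \<open>The extended real argument admits the infinite outer thresholds, so the integral over
  any bin is a difference of two values.\<close>

definition cum :: "real \<Rightarrow> (real \<Rightarrow> real) \<Rightarrow> ereal \<Rightarrow> real" where
  "cum \<sigma> g e = (LINT x:{x. ereal x \<le> e}|gaussian \<sigma>. g x)"

lemma set_integrable_gaussian:
  fixes g :: "real \<Rightarrow> real"
  assumes "integrable (gaussian \<sigma>) g" "A \<in> sets borel"
  shows "set_integrable (gaussian \<sigma>) A g"
  using assms unfolding set_integrable_def by (intro Bochner_Integration.integrable_mult_indicator) auto

lemma set_lebesgue_integral_gaussian:
  assumes [measurable]: "g \<in> borel_measurable borel" "A \<in> sets borel"
  shows "(LINT x:A|gaussian \<sigma>. g x) = (LINT x:A|lborel. normal_density 0 \<sigma> x * g x)"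
  unfolding set_lebesgue_integral_def gaussian_def
  by (subst integral_density) (auto intro!: Bochner_Integration.integral_cong simp: mult_ac)

lemma integrable_gaussian_iff:
  assumes [measurable]: "g \<in> borel_measurable borel"
  shows "integrable (gaussian \<sigma>) g \<longleftrightarrow> integrable lborel (\<lambda>x. normal_density 0 \<sigma> x * g x)"
  unfolding gaussian_def by (subst integrable_density) auto

lemma integrable_gaussian_power:
  assumes "\<sigma> > 0"
  shows "integrable (gaussian \<sigma>) (\<lambda>x. x ^ k)"
  using integrable_normal_moment[OF assms, of 0 k] by (simp add: integrable_gaussian_iff)

lemma integrable_gaussian_square_diff:
  assumes "\<sigma> > 0"
  shows "integrable (gaussian \<sigma>) (\<lambda>x. (x - c)\<^sup>2)"
proof -
  interpret prob_space "gaussian \<sigma>" by (rule prob_space_gaussian[OF assms])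
  have "(\<lambda>x. (x - c)\<^sup>2) = (\<lambda>x. x ^ 2 - 2 * c * x ^ 1 + c\<^sup>2)"
    by (auto simp: power2_eq_square algebra_simps)
  then show ?thesis
    using integrable_gaussian_power[OF assms, of 1] integrable_gaussian_power[OF assms, of 2] by simp
qed

lemma slab_integral:
  assumes "integrable (gaussian \<sigma>) g" and "a \<le> b"
  shows "(LINT x:{x. a < ereal x \<and> ereal x \<le> b}|gaussian \<sigma>. g x) = cum \<sigma> g b - cum \<sigma> g a"
proof -
  have "{x. ereal x \<le> b} = {x. ereal x \<le> a} \<union> {x. a < ereal x \<and> ereal x \<le> b}"
    using assms(2) by (auto intro: order_trans)
  then have "cum \<sigma> g b = cum \<sigma> g a + (LINT x:{x. a < ereal x \<and> ereal x \<le> b}|gaussian \<sigma>. g x)"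
    unfolding cum_def by (simp only:)
      (intro set_integral_Un set_integrable_gaussian[OF assms(1)], auto)
  then show ?thesis by simp
qed

text \<open>Near \<open>t0\<close> only the integral from \<open>t0 - 1\<close> to \<open>t\<close>
  varies, and the fundamental theorem of calculus applies to it. The tail to the left is
  constant.\<close>

lemma cum_has_real_derivative:
  assumes \<sigma>: "\<sigma> > 0" and g: "integrable (gaussian \<sigma>) g" "continuous_on UNIV g"
  shows "((\<lambda>t. cum \<sigma> g (ereal t)) has_real_derivative normal_density 0 \<sigma> t0 * g t0) (at t0)"
proof -
  let ?f = "\<lambda>x. normal_density 0 \<sigma> x * g x" and ?c = "t0 - 1" and ?d = "t0 + 1"
  have [measurable]: "g \<in> borel_measurable borel"
    using g(2) by (rule borel_measurable_continuous_onI)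
  have f: "integrable lborel ?f" using g(1) by (simp add: integrable_gaussian_iff)
  have set_f: "set_integrable lborel A ?f" if "A \<in> sets borel" for A
    unfolding set_integrable_def using that by (intro Bochner_Integration.integrable_mult_indicator f) auto
  have "continuous_on {?c..?d} ?f"
    unfolding normal_density_def
    using \<sigma> by (intro continuous_intros continuous_on_subset[OF g(2)]) auto
  then have "((\<lambda>t. integral {?c..t} ?f) has_real_derivative ?f t0) (at t0 within {?c..?d})"
    by (rule integral_has_real_derivative) auto
  then have "((\<lambda>t. integral {?c..t} ?f) has_real_derivative ?f t0) (at t0)"
    by (simp add: at_within_Icc_at)
  then have "((\<lambda>t. (LINT x:{..<?c}|lborel. ?f x) + integral {?c..t} ?f) has_real_derivative ?f t0) (at t0)"
    by (auto intro!: derivative_eq_intros)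
  moreover have "(LINT x:{..<?c}|lborel. ?f x) + integral {?c..t} ?f = cum \<sigma> g (ereal t)"
    if "t \<in> {?c<..<?d}" for t
  proof -
    have "{x. ereal x \<le> ereal t} = {..<?c} \<union> {?c..t}" using that by auto
    then have "cum \<sigma> g (ereal t) = (LINT x:{..<?c}|lborel. ?f x) + (LINT x:{?c..t}|lborel. ?f x)"
      unfolding cum_def by (subst set_lebesgue_integral_gaussian)
        (simp, simp, simp only:, intro set_integral_Un set_f, auto)
    also have "(LINT x:{?c..t}|lborel. ?f x) = integral {?c..t} ?f"
      by (rule set_borel_integral_eq_integral(2)) (rule set_f, simp)
    finally show ?thesis by simp
  qed
  ultimately show ?thesis
    using has_field_derivative_transform_within_open[where S = "{?c<..<?d}" and a = t0
        and g = "\<lambda>t. cum \<sigma> g (ereal t)"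
        and f = "\<lambda>t. (LINT x:{..<?c}|lborel. ?f x) + integral {?c..t} ?f"]
    by auto
qed

text \<open>Makes the weights bin integrals of the constant 1, so that they share the derivative and
  continuity results for such integrals.\<close>

lemma measure_gaussian_eq_integral:
  assumes "A \<in> sets borel"
  shows "measure (gaussian \<sigma>) A = (LINT x:A|gaussian \<sigma>. 1)"
  using assms by (simp add: set_lebesgue_integral_def)

lemma threshold_less:
  assumes "strict_mono_on {1..<n} \<zeta>" "i < j" "j \<le> n"
  shows "threshold n \<zeta> i < threshold n \<zeta> j"
  using assms strict_mono_onD[OF assms(1), of i j] by (auto simp: threshold_def)

lemma bin_measurable [measurable, simp]: "bin n \<zeta> i \<in> sets borel"
  unfolding bin_def by measurable

lemma bin_integral:
  assumes "strict_mono_on {1..<n} \<zeta>" "i \<in> {1..n}" "integrable (gaussian \<sigma>) g"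
  shows "(LINT x:bin n \<zeta> i|gaussian \<sigma>. g x)
    = cum \<sigma> g (threshold n \<zeta> i) - cum \<sigma> g (threshold n \<zeta> (i - 1))"
  unfolding bin_def using assms(2)
  by (intro slab_integral[OF assms(3) less_imp_le[OF threshold_less[OF assms(1)]]]) auto

text \<open>The bin contains a nondegenerate finite interval, and \<open>cum\<close> of the constant
  1 is strictly increasing because its derivative is the positive Gaussian density.\<close>

lemma weight_pos:
  assumes "\<sigma> > 0" "strict_mono_on {1..<n} \<zeta>" "i \<in> {1..n}"
  shows "weight (gaussian \<sigma>) n \<zeta> i > 0"
proof -
  interpret prob_space "gaussian \<sigma>" by (rule prob_space_gaussian[OF assms(1)])
  have "threshold n \<zeta> (i - 1) < threshold n \<zeta> i"
    using assms(3) by (intro threshold_less[OF assms(2)]) auto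
  then obtain a where a: "threshold n \<zeta> (i - 1) < ereal a" "ereal a < threshold n \<zeta> i"
    using ereal_dense2 by blast
  then obtain b where b: "ereal a < ereal b" "ereal b < threshold n \<zeta> i"
    using ereal_dense2 by blast
  have "cum \<sigma> (\<lambda>_. 1) (ereal a) < cum \<sigma> (\<lambda>_. 1) (ereal b)"
  proof (rule DERIV_pos_imp_increasing[where f = "\<lambda>t. cum \<sigma> (\<lambda>_. 1) (ereal t)"])
    show "a < b" using b by simp
    show "\<exists>y. ((\<lambda>t. cum \<sigma> (\<lambda>_. 1) (ereal t)) has_real_derivative y) (at t) \<and> y > 0" for t
      using cum_has_real_derivative[OF assms(1), of "\<lambda>_. 1" t] normal_density_pos[OF assms(1), of 0 t] by auto
  qed
  also have "cum \<sigma> (\<lambda>_. 1) (ereal b) - cum \<sigma> (\<lambda>_. 1) (ereal a)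
      = measure (gaussian \<sigma>) {x. ereal a < ereal x \<and> ereal x \<le> ereal b}"
    using b by (subst measure_gaussian_eq_integral)
      (simp, intro slab_integral[symmetric], auto simp: less_imp_le)
  finally have "0 < measure (gaussian \<sigma>) {x. ereal a < ereal x \<and> ereal x \<le> ereal b}" by simp
  also have "\<dots> \<le> weight (gaussian \<sigma>) n \<zeta> i"
    unfolding weight_def
  proof (intro finite_measure_mono subsetI)
    fix x assume "x \<in> {x. ereal a < ereal x \<and> ereal x \<le> ereal b}"
    then show "x \<in> bin n \<zeta> i"
      using less_trans[OF a(1)] order_trans[OF _ less_imp_le[OF b(2)]] by (simp add: bin_def)
  qed simp
  finally show ?thesis .
qed

lemma weight_cum:
  assumes "\<sigma> > 0" "strict_mono_on {1..<n} \<zeta>" "i \<in> {1..n}"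
  shows "weight (gaussian \<sigma>) n \<zeta> i
    = cum \<sigma> (\<lambda>_. 1) (threshold n \<zeta> i) - cum \<sigma> (\<lambda>_. 1) (threshold n \<zeta> (i - 1))"
proof -
  interpret prob_space "gaussian \<sigma>" by (rule prob_space_gaussian[OF assms(1)])
  show ?thesis
    unfolding weight_def
    by (subst measure_gaussian_eq_integral) (simp, intro bin_integral assms, simp)
qed

lemma prob_weights_weight:
  assumes "\<sigma> > 0" "n \<ge> 1" "strict_mono_on {1..<n} \<zeta>"
  shows "prob_weights n (weight (gaussian \<sigma>) n \<zeta>)"
proof -
  interpret prob_space "gaussian \<sigma>" by (rule prob_space_gaussian[OF assms(1)])
  let ?C = "\<lambda>i. cum \<sigma> (\<lambda>_. 1) (threshold n \<zeta> i)"
  have "(\<Sum>i=1..n. weight (gaussian \<sigma>) n \<zeta> i) = (\<Sum>i\<in>{Suc 0..n}. ?C i - ?C (i - 1))"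
    using weight_cum[OF assms(1,3)] by (intro sum.cong) auto
  also have "\<dots> = ?C n - ?C 0" by (rule sum_telescope'') simp
  also have "\<dots> = 1"
    using assms(2) prob_space by (simp add: threshold_def cum_def set_lebesgue_integral_def)
  finally show ?thesis
    using weight_pos[OF assms(1,3)] by (simp add: prob_weights_def)
qed

text \<open>Finitely many strict inequalities persist under small perturbations. The filter is
  \<open>nhds\<close>, including the point itself, since replacing a function inside a derivative
  requires agreement there too.\<close>

lemma eventually_strict_mono_on_upd:
  fixes \<zeta> :: "nat \<Rightarrow> real"
  assumes "strict_mono_on {1..<n} \<zeta>"
  shows "\<forall>\<^sub>F t in nhds (\<zeta> i). strict_mono_on {1..<n} (\<zeta>(i := t))"
proof -
  have lim: "((\<lambda>t. (\<zeta>(i := t)) b - (\<zeta>(i := t)) a) \<longlongrightarrow> \<zeta> b - \<zeta> a) (nhds (\<zeta> i))" for a b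
    by (cases "a = i"; cases "b = i") (auto intro!: tendsto_intros filterlim_ident)
  have "\<forall>\<^sub>F t in nhds (\<zeta> i). a < b \<longrightarrow> (\<zeta>(i := t)) b - (\<zeta>(i := t)) a > 0"
    if "a \<in> {1..<n}" "b \<in> {1..<n}" for a b
    using order_tendstoD(1)[OF lim[of b a], of 0] strict_mono_onD[OF assms that] by (cases "a < b") auto
  then have "\<forall>\<^sub>F t in nhds (\<zeta> i). \<forall>a\<in>{1..<n}. \<forall>b\<in>{1..<n}. a < b \<longrightarrow> (\<zeta>(i := t)) b - (\<zeta>(i := t)) a > 0"
    by (intro eventually_ball_finite ballI) auto
  then show ?thesis
    by eventually_elim (auto simp: strict_mono_on_def simp del: fun_upd_apply)
qed

text \<open>Raising the threshold \<open>\<zeta> i\<close> moves mass from bin \<open>i + 1\<close> to bin \<open>i\<close>.\<close>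

definition cut_sign :: "nat \<Rightarrow> nat \<Rightarrow> real" where
  "cut_sign i j = (if j = i then 1 else if j = Suc i then - 1 else 0)"

lemma sum_cut_sign:
  assumes "i \<in> {1..<n}"
  shows "(\<Sum>j=1..n. cut_sign i j * f j) = f i - f (Suc i)"
proof -
  have "(\<Sum>j=1..n. cut_sign i j * f j)
      = (\<Sum>j=1..n. (if j = i then f j else 0) - (if j = Suc i then f j else 0))"
    by (intro sum.cong) (auto simp: cut_sign_def)
  then show ?thesis using assms by (simp add: sum_subtractf)
qed

text \<open>The threshold \<open>\<zeta> i\<close> occurs only as the upper end of bin
  \<open>i\<close> and the lower end of bin \<open>i + 1\<close>. The expression through
  \<open>cum\<close> needs ordered thresholds and hence holds only near
  \<open>\<zeta> i\<close>.\<close>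

lemma bin_integral_has_real_derivative:
  assumes \<sigma>: "\<sigma> > 0" and \<zeta>: "strict_mono_on {1..<n} \<zeta>" and i: "i \<in> {1..<n}" and j: "j \<in> {1..n}"
    and g: "integrable (gaussian \<sigma>) g" "continuous_on UNIV g"
  shows "((\<lambda>t. LINT x:bin n (\<zeta>(i := t)) j|gaussian \<sigma>. g x) has_real_derivative
      cut_sign i j * (normal_density 0 \<sigma> (\<zeta> i) * g (\<zeta> i))) (at (\<zeta> i))"
proof -
  have thr: "threshold n (\<zeta>(i := t)) k = (if k = i then ereal t else threshold n \<zeta> k)" for t k
    using i by (auto simp: threshold_def)
  have ev: "\<forall>\<^sub>F t in nhds (\<zeta> i). (LINT x:bin n (\<zeta>(i := t)) j|gaussian \<sigma>. g x)
      = (if j = i then cum \<sigma> g (ereal t) else cum \<sigma> g (threshold n \<zeta> j))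
        - (if j - 1 = i then cum \<sigma> g (ereal t) else cum \<sigma> g (threshold n \<zeta> (j - 1)))"
    using eventually_strict_mono_on_upd[OF \<zeta>, of i]
    by eventually_elim (simp add: bin_integral[OF _ j g(1)] thr)
  have j_pred: "j - 1 = i \<longleftrightarrow> j = Suc i" using i j by auto
  show ?thesis
    unfolding DERIV_cong_ev[OF refl ev refl] j_pred cut_sign_def
    using cum_has_real_derivative[OF \<sigma> g, of "\<zeta> i"]
    by (cases "j = i"; cases "j = Suc i") (auto intro!: derivative_eq_intros)
qed

lemma weight_has_real_derivative:
  assumes "\<sigma> > 0" "strict_mono_on {1..<n} \<zeta>" "i \<in> {1..<n}" "j \<in> {1..n}"
  shows "((\<lambda>t. weight (gaussian \<sigma>) n (\<zeta>(i := t)) j) has_real_derivative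
      cut_sign i j * normal_density 0 \<sigma> (\<zeta> i)) (at (\<zeta> i))"
proof -
  interpret prob_space "gaussian \<sigma>" by (rule prob_space_gaussian[OF assms(1)])
  show ?thesis
    using bin_integral_has_real_derivative[OF assms, of "\<lambda>_. 1"]
    by (simp add: weight_def measure_gaussian_eq_integral)
qed

section \<open>Derivatives of the objective\<close>

lemma distortion_has_derivative_threshold:
  assumes "\<sigma> > 0" "strict_mono_on {1..<n} \<zeta>" "i \<in> {1..<n}"
  shows "((\<lambda>t. distortion (gaussian \<sigma>) n y (\<zeta>(i := t))) has_real_derivative
    normal_density 0 \<sigma> (\<zeta> i) * ((\<zeta> i - y i)\<^sup>2 - (\<zeta> i - y (Suc i))\<^sup>2)) (at (\<zeta> i))"
proof -
  have "((\<lambda>t. distortion (gaussian \<sigma>) n y (\<zeta>(i := t))) has_real_derivative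
      (\<Sum>j=1..n. cut_sign i j * (normal_density 0 \<sigma> (\<zeta> i) * (\<zeta> i - y j)\<^sup>2))) (at (\<zeta> i))"
    unfolding distortion_def
    by (intro DERIV_sum bin_integral_has_real_derivative assms integrable_gaussian_square_diff)
       (auto intro!: continuous_intros)
  then show ?thesis
    unfolding sum_cut_sign[OF assms(3)] right_diff_distrib .
qed

text \<open>Exhibits the distortion as a quadratic polynomial in each level, so that it can be
  differentiated without exchanging derivative and integral.\<close>

lemma bin_square_integral:
  assumes "\<sigma> > 0" and A[simp]: "A \<in> sets borel"
  shows "(LINT x:A|gaussian \<sigma>. (x - c)\<^sup>2)
    = (LINT x:A|gaussian \<sigma>. x\<^sup>2) - 2 * c * (LINT x:A|gaussian \<sigma>. x) + c\<^sup>2 * measure (gaussian \<sigma>) A"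
proof -
  interpret prob_space "gaussian \<sigma>" by (rule prob_space_gaussian[OF assms(1)])
  have int: "set_integrable (gaussian \<sigma>) A (\<lambda>x. x ^ k)" for k
    by (intro set_integrable_gaussian integrable_gaussian_power assms)
  have "(LINT x:A|gaussian \<sigma>. (x - c)\<^sup>2)
      = (LINT x:A|gaussian \<sigma>. (x ^ 2 - 2 * c * x ^ 1) + c\<^sup>2 * x ^ 0)"
    by (simp add: power2_eq_square algebra_simps)
  also have "\<dots> = (LINT x:A|gaussian \<sigma>. x ^ 2) - 2 * c * (LINT x:A|gaussian \<sigma>. x ^ 1)
      + c\<^sup>2 * (LINT x:A|gaussian \<sigma>. x ^ 0)"
    by (subst set_integral_add, intro set_integral_diff set_integrable_mult_right int,
        intro set_integrable_mult_right int, subst set_integral_diff,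
        intro int, intro set_integrable_mult_right int) (simp only: set_integral_mult_right)
  finally show ?thesis
    by (simp add: measure_gaussian_eq_integral)
qed

lemma distortion_has_derivative_level:
  assumes "\<sigma> > 0" "strict_mono_on {1..<n} \<zeta>" "i \<in> {1..n}"
  shows "((\<lambda>t. distortion (gaussian \<sigma>) n (y(i := t)) \<zeta>) has_real_derivative
    2 * weight (gaussian \<sigma>) n \<zeta> i * (y i - centroid (gaussian \<sigma>) (bin n \<zeta> i))) (at (y i))"
proof -
  let ?M = "\<lambda>k j. LINT x:bin n \<zeta> j|gaussian \<sigma>. x ^ k" and ?w = "weight (gaussian \<sigma>) n \<zeta>"
  have "((\<lambda>t. \<Sum>j=1..n. ?M 2 j - 2 * (y(i := t)) j * ?M 1 j + ((y(i := t)) j)\<^sup>2 * ?w j) has_real_derivative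
      (\<Sum>j=1..n. if j = i then 2 * y i * ?w i - 2 * ?M 1 i else 0)) (at (y i))"
  proof (rule DERIV_sum)
    fix j
    show "((\<lambda>t. ?M 2 j - 2 * (y(i := t)) j * ?M 1 j + ((y(i := t)) j)\<^sup>2 * ?w j) has_real_derivative
      (if j = i then 2 * y i * ?w i - 2 * ?M 1 i else 0)) (at (y i))"
      by (cases "j = i") (auto intro!: derivative_eq_intros)
  qed
  moreover have "2 * y i * ?w i - 2 * ?M 1 i = 2 * ?w i * (y i - centroid (gaussian \<sigma>) (bin n \<zeta> i))"
    using weight_pos[OF assms] by (simp add: centroid_def weight_def field_simps)
  ultimately show ?thesis
    using assms(3) by (simp add: distortion_def bin_square_integral[OF assms(1)] weight_def)
qed

text \<open>With the levels fixed, a threshold acts on the MMSE only through the weights of its two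
  adjacent bins, whose derivatives are opposite.\<close>

lemma mmse_has_derivative_threshold:
  assumes "\<sigma> > 0" "n \<ge> 1" "strict_mono_on {1..<n} \<zeta>" "i \<in> {1..<n}"
  shows "((\<lambda>t. mmse (quantized (gaussian \<sigma>) n y (\<zeta>(i := t)))) has_real_derivative
    normal_density 0 \<sigma> (\<zeta> i) * (Psi (quantized (gaussian \<sigma>) n y \<zeta>) (y i)
      - Psi (quantized (gaussian \<sigma>) n y \<zeta>) (y (Suc i)))) (at (\<zeta> i))"
proof -
  let ?w = "\<lambda>t. weight (gaussian \<sigma>) n (\<zeta>(i := t))" and ?p = "normal_density 0 \<sigma> (\<zeta> i)"
  have w0: "prob_weights n (?w (\<zeta> i))"
    using prob_weights_weight[OF assms(1-3)] by simp
  have "\<forall>\<^sub>F t in nhds (\<zeta> i). prob_weights n (?w t)"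
    using eventually_strict_mono_on_upd[OF assms(3)] by eventually_elim (intro prob_weights_weight assms)
  then have "\<forall>\<^sub>F t in at (\<zeta> i). prob_weights n (?w t)"
    unfolding eventually_at_filter by eventually_elim simp
  then have "((\<lambda>t. mmse (atoms n (?w t) y)) has_real_derivative
      (\<Sum>j=1..n. (cut_sign i j * ?p) * psi (post n (?w (\<zeta> i)) y) (y j))) (at (\<zeta> i))"
    by (intro mmse_weights_has_real_derivative weight_has_real_derivative w0 assms)
  moreover have "(\<Sum>j=1..n. (cut_sign i j * ?p) * psi (post n (?w (\<zeta> i)) y) (y j))
      = ?p * (psi (post n (?w (\<zeta> i)) y) (y i) - psi (post n (?w (\<zeta> i)) y) (y (Suc i)))"
    unfolding mult.assoc sum_cut_sign[OF assms(4)] by (simp add: right_diff_distrib)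
  moreover have "Psi (quantized (gaussian \<sigma>) n y \<zeta>) = psi (post n (?w (\<zeta> i)) y)"
    unfolding quantized_def using w0 by (simp add: finite_input.Psi_atoms finite_input.intro)
  ultimately show ?thesis by (simp add: quantized_def)
qed

section \<open>Stationarity as explicit equations, and bounds on the corrections\<close>

lemma stationary_iff:
  assumes "\<And>i. i \<in> {1..n} \<Longrightarrow> ((\<lambda>t. F (y(i := t)) \<zeta>) has_real_derivative D i) (at (y i))"
    and "\<And>i. i \<in> {1..<n} \<Longrightarrow> ((\<lambda>t. F y (\<zeta>(i := t))) has_real_derivative E i) (at (\<zeta> i))"
  shows "stationary n F y \<zeta> \<longleftrightarrow> (\<forall>i\<in>{1..n}. D i = 0) \<and> (\<forall>i\<in>{1..<n}. E i = 0)"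
  unfolding stationary_def using assms by (metis DERIV_unique)

text \<open>The squares of \<open>z\<close> cancel, so the equation is linear in \<open>z\<close>.
  The value \<open>c = 0\<close> yields the midpoint, and the scaled difference of
  \<open>Psi\<close> yields the corrected threshold.\<close>

lemma square_diff_eq_iff:
  fixes a b z c :: real
  assumes "a < b"
  shows "(z - a)\<^sup>2 - (z - b)\<^sup>2 = c \<longleftrightarrow> z = (a + b) / 2 + c / (2 * (b - a))"
proof -
  have "(z - a)\<^sup>2 - (z - b)\<^sup>2 = (z - (a + b) / 2) * (2 * (b - a))"
    by (simp add: power2_eq_square field_simps)
  then have "(z - a)\<^sup>2 - (z - b)\<^sup>2 = c \<longleftrightarrow> z - (a + b) / 2 = c / (2 * (b - a))"
    using assms by (simp add: eq_divide_eq)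
  then show ?thesis by auto
qed

locale gaussian_quantizer =
  fixes \<sigma> :: real and n :: nat and y \<zeta> :: "nat \<Rightarrow> real"
  assumes \<sigma>_pos: "\<sigma> > 0" and n_ge_1: "n \<ge> 1" and adm: "admissible n y \<zeta>"
begin

abbreviation "P \<equiv> gaussian \<sigma>"
abbreviation "W \<equiv> weight P n \<zeta>"

lemma mono_\<zeta>: "strict_mono_on {1..<n} \<zeta>" and mono_y: "strict_mono_on {1..n} y"
  using adm by (auto simp: admissible_def)

sublocale finite_input n W y
  using prob_weights_weight[OF \<sigma>_pos n_ge_1 mono_\<zeta>] by unfold_locales

lemma y_less: "i \<in> {1..<n} \<Longrightarrow> y i < y (i + 1)"
  by (rule strict_mono_onD[OF mono_y]) auto

lemma lloyd_max_iff:
  "lloyd_max P n y \<zeta> \<longleftrightarrow>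
    (\<forall>i\<in>{1..n}. y i = centroid P (bin n \<zeta> i)) \<and> (\<forall>i\<in>{1..<n}. \<zeta> i = (y i + y (i + 1)) / 2)"
proof -
  have "lloyd_max P n y \<zeta> \<longleftrightarrow>
      (\<forall>i\<in>{1..n}. 2 * W i * (y i - centroid P (bin n \<zeta> i)) = 0) \<and>
      (\<forall>i\<in>{1..<n}. normal_density 0 \<sigma> (\<zeta> i) * ((\<zeta> i - y i)\<^sup>2 - (\<zeta> i - y (Suc i))\<^sup>2) = 0)"
    unfolding lloyd_max_def
    by (rule stationary_iff)
       (intro distortion_has_derivative_level distortion_has_derivative_threshold \<sigma>_pos mono_\<zeta>; assumption)+
  also have "\<dots> \<longleftrightarrow>
      (\<forall>i\<in>{1..n}. y i = centroid P (bin n \<zeta> i)) \<and> (\<forall>i\<in>{1..<n}. \<zeta> i = (y i + y (i + 1)) / 2)"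
  proof (intro conj_cong ball_cong refl)
    fix i assume "i \<in> {1..n}"
    then show "2 * W i * (y i - centroid P (bin n \<zeta> i)) = 0 \<longleftrightarrow> y i = centroid P (bin n \<zeta> i)"
      using w_pos[of i] by simp
  next
    fix i assume "i \<in> {1..<n}"
    then show "normal_density 0 \<sigma> (\<zeta> i) * ((\<zeta> i - y i)\<^sup>2 - (\<zeta> i - y (Suc i))\<^sup>2) = 0
        \<longleftrightarrow> \<zeta> i = (y i + y (i + 1)) / 2"
      using square_diff_eq_iff[OF y_less, of i "\<zeta> i" 0] normal_density_pos[OF \<sigma>_pos, of 0 "\<zeta> i"] by simp
  qed
  finally show ?thesis .
qed

lemma stationary_objective_iff:
  assumes "k > 0"
  shows "stationary n (objective P n k) y \<zeta> \<longleftrightarrow>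
    (\<forall>i\<in>{1..n}. y i - centroid P (bin n \<zeta> i) = level_correction P n k y \<zeta> i) \<and>
    (\<forall>i\<in>{1..<n}. \<zeta> i = (y i + y (i + 1)) / 2 + threshold_correction P n k y \<zeta> i)"
proof -
  let ?D = "\<lambda>i. deriv (mmse_slice n W y i) (y i)" and ?Psi = "Psi (quantized P n y \<zeta>)"
    and ?p = "\<lambda>i. normal_density 0 \<sigma> (\<zeta> i)"
  have level: "((\<lambda>t. objective P n k (y(i := t)) \<zeta>) has_real_derivative
      k\<^sup>2 * (2 * W i * (y i - centroid P (bin n \<zeta> i))) + ?D i) (at (y i))" if "i \<in> {1..n}" for i
  proof -
    have "(mmse_slice n W y i has_real_derivative ?D i) (at (y i))"
      using mmse_slice_has_real_derivative[OF that] DERIV_imp_deriv by metis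
    then show ?thesis
      unfolding objective_def quantized_def mmse_slice_def[abs_def]
      by (intro DERIV_add DERIV_cmult distortion_has_derivative_level \<sigma>_pos mono_\<zeta> that)
  qed
  have thr: "((\<lambda>t. objective P n k y (\<zeta>(i := t))) has_real_derivative
      k\<^sup>2 * (?p i * ((\<zeta> i - y i)\<^sup>2 - (\<zeta> i - y (Suc i))\<^sup>2)) + ?p i * (?Psi (y i) - ?Psi (y (Suc i)))) (at (\<zeta> i))"
    if "i \<in> {1..<n}" for i
    unfolding objective_def
    by (intro DERIV_add DERIV_cmult distortion_has_derivative_threshold
        mmse_has_derivative_threshold \<sigma>_pos n_ge_1 mono_\<zeta> that)
  have "stationary n (objective P n k) y \<zeta> \<longleftrightarrow>
      (\<forall>i\<in>{1..n}. k\<^sup>2 * (2 * W i * (y i - centroid P (bin n \<zeta> i))) + ?D i = 0) \<and>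
      (\<forall>i\<in>{1..<n}. k\<^sup>2 * (?p i * ((\<zeta> i - y i)\<^sup>2 - (\<zeta> i - y (Suc i))\<^sup>2)) + ?p i * (?Psi (y i) - ?Psi (y (Suc i))) = 0)"
    by (rule stationary_iff) (fact level thr)+
  also have "\<dots> \<longleftrightarrow>
    (\<forall>i\<in>{1..n}. y i - centroid P (bin n \<zeta> i) = level_correction P n k y \<zeta> i) \<and>
    (\<forall>i\<in>{1..<n}. \<zeta> i = (y i + y (i + 1)) / 2 + threshold_correction P n k y \<zeta> i)"
  proof (intro conj_cong ball_cong refl)
    fix i assume i: "i \<in> {1..n}"
    show "k\<^sup>2 * (2 * W i * (y i - centroid P (bin n \<zeta> i))) + ?D i = 0
        \<longleftrightarrow> y i - centroid P (bin n \<zeta> i) = level_correction P n k y \<zeta> i"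
    proof -
      have "k\<^sup>2 * (2 * W i * x) + d = 0 \<longleftrightarrow> x = - (d / (2 * k\<^sup>2 * W i))" for x d :: real
        using assms w_pos[OF i] by (auto simp: field_simps)
      then show ?thesis unfolding level_correction_def .
    qed
  next
    fix i assume i: "i \<in> {1..<n}"
    \<comment> \<open>Distortion and MMSE both change at the rate of mass crossing the threshold, so
      the positive density \<open>?p i\<close> is a common factor and drops out.\<close>
    have "k\<^sup>2 * (?p i * a) + ?p i * (b - c) = 0 \<longleftrightarrow> a = (c - b) / k\<^sup>2" for a b c :: real
    proof -
      have "k\<^sup>2 * (?p i * a) + ?p i * (b - c) = ?p i * (k\<^sup>2 * a + (b - c))"
        by (simp add: algebra_simps)
      then have "k\<^sup>2 * (?p i * a) + ?p i * (b - c) = 0 \<longleftrightarrow> k\<^sup>2 * a + (b - c) = 0"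
        using normal_density_pos[OF \<sigma>_pos, of 0 "\<zeta> i"] by simp
      then show ?thesis
        using assms by (auto simp: field_simps)
    qed
    note scale = this
    have "y i < y (Suc i)" using y_less[OF i] by simp
    then show "k\<^sup>2 * (?p i * ((\<zeta> i - y i)\<^sup>2 - (\<zeta> i - y (Suc i))\<^sup>2)) + ?p i * (?Psi (y i) - ?Psi (y (Suc i))) = 0
        \<longleftrightarrow> \<zeta> i = (y i + y (i + 1)) / 2 + threshold_correction P n k y \<zeta> i"
      unfolding scale threshold_correction_def
      by (simp only: square_diff_eq_iff divide_divide_eq_left mult_ac Suc_eq_plus1)
  qed
  finally show ?thesis .
qed

text \<open>No sign of \<open>k\<close> enters: at \<open>k = 0\<close> both sides are 0 by the
  convention for division. The bound is thus available at every index of a limit in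
  \<open>k\<close>.\<close>

lemma level_correction_bound:
  assumes i: "i \<in> {1..n}" and R: "\<And>j. j \<in> {1..n} \<Longrightarrow> \<bar>y j\<bar> \<le> R"
  shows "\<bar>level_correction P n k y \<zeta> i\<bar> \<le> psi_lip (R + 1) / (2 * k\<^sup>2)"
proof -
  have "\<bar>level_correction P n k y \<zeta> i\<bar> = \<bar>deriv (mmse_slice n W y i) (y i)\<bar> / (2 * k\<^sup>2 * W i)"
    using w_pos[OF i] by (simp add: level_correction_def abs_mult)
  also have "\<dots> \<le> W i * psi_lip (R + 1) / (2 * k\<^sup>2 * W i)"
    using w_pos[OF i] by (intro divide_right_mono deriv_mmse_slice_bound i R) auto
  finally show ?thesis using w_pos[OF i] by (simp add: mult_ac)
qed

lemma threshold_correction_bound: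
  assumes i: "i \<in> {1..<n}" and R: "\<And>j. j \<in> {1..n} \<Longrightarrow> \<bar>y j\<bar> \<le> R"
  shows "\<bar>threshold_correction P n k y \<zeta> i\<bar> \<le> psi_lip R / (2 * k\<^sup>2)"
proof -
  let ?d = "y (i + 1) - y i"
  have "\<bar>Psi (quantized P n y \<zeta>) (y (i + 1)) - Psi (quantized P n y \<zeta>) (y i)\<bar> \<le> psi_lip R * \<bar>?d\<bar>"
    unfolding quantized_def Psi_atoms using i
    by (intro psi_lipschitz post_measurable post_bound R) auto
  then have "\<bar>threshold_correction P n k y \<zeta> i\<bar> \<le> psi_lip R * \<bar>?d\<bar> / \<bar>2 * k\<^sup>2 * ?d\<bar>"
    unfolding threshold_correction_def abs_divide by (intro divide_right_mono) auto
  \<comment> \<open>The gap between adjacent levels, supplied by the Lipschitz bound, cancels the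
    one in the denominator.\<close>
  also have "\<dots> = psi_lip R / (2 * k\<^sup>2)"
    using y_less[OF i] by (simp add: abs_mult)
  finally show ?thesis .
qed

section \<open>Closed bins and Voronoi cells\<close>

text \<open>Bins are half-open while Voronoi cells are closed, so the two are compared after
  closure. Only a finite left endpoint can be missing, and points of the bin approach it from the
  right.\<close>

lemma closure_bin:
  assumes i: "i \<in> {1..n}"
  shows "closure (bin n \<zeta> i) = {x. threshold n \<zeta> (i - 1) \<le> ereal x \<and> ereal x \<le> threshold n \<zeta> i}"
    (is "_ = ?S")
proof
  have "closed ?S"
    by (intro closed_Collect_conj closed_Collect_le continuous_intros)
  then show "closure (bin n \<zeta> i) \<subseteq> ?S"
    by (intro closure_minimal) (auto simp: bin_def)
  show "?S \<subseteq> closure (bin n \<zeta> i)"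
  proof
    fix x assume x: "x \<in> ?S"
    have less: "threshold n \<zeta> (i - 1) < threshold n \<zeta> i"
      using i by (intro threshold_less[OF mono_\<zeta>]) auto
    show "x \<in> closure (bin n \<zeta> i)"
    proof (cases "x \<in> bin n \<zeta> i")
      case False
      then have thr: "threshold n \<zeta> (i - 1) = ereal x" using x by (auto simp: bin_def)
      show ?thesis
        unfolding closure_approachable
      proof (intro allI impI)
        fix e :: real assume "e > 0"
        then have "ereal x < min (threshold n \<zeta> i) (ereal (x + e))" using less thr by simp
        then obtain u where u: "ereal x < ereal u" "ereal u < min (threshold n \<zeta> i) (ereal (x + e))"
          using ereal_dense2 by blast
        then show "\<exists>u\<in>bin n \<zeta> i. dist u x < e"
          by (intro bexI[of _ u]) (auto simp: bin_def dist_real_def simp del: One_nat_def simp add: thr)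
      qed
    qed (use closure_subset in blast)
  qed
qed

lemma centroid_closure_bin:
  assumes i: "i \<in> {1..n}"
  shows "centroid P (closure (bin n \<zeta> i)) = centroid P (bin n \<zeta> i)"
proof -
  interpret G: prob_space P by (rule prob_space_gaussian[OF \<sigma>_pos])
  \<comment> \<open>For an infinite threshold \<open>real_of_ereal\<close> returns 0, which merely
    excludes one more null point.\<close>
  have "AE x in lborel. x \<noteq> real_of_ereal (threshold n \<zeta> (i - 1))" by (rule AE_lborel_singleton)
  then have "AE x in P. x \<noteq> real_of_ereal (threshold n \<zeta> (i - 1))"
    unfolding gaussian_def by (subst AE_density) auto
  then have ae: "AE x in P. x \<in> closure (bin n \<zeta> i) \<longleftrightarrow> x \<in> bin n \<zeta> i"
    unfolding closure_bin[OF i]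
  proof eventually_elim
    case (elim x)
    have "threshold n \<zeta> (i - 1) \<noteq> ereal x" using elim by auto
    then show ?case by (simp add: bin_def order_le_less del: One_nat_def)
  qed
  have sets[measurable]: "closure (bin n \<zeta> i) \<in> sets borel" by simp
  have cong: "(LINT x:closure (bin n \<zeta> i)|P. g x) = (LINT x:bin n \<zeta> i|P. g x)"
    if [measurable]: "g \<in> borel_measurable borel" for g :: "real \<Rightarrow> real"
    using ae sets by (intro set_integral_cong_set) (auto simp: set_borel_measurable_def)
  show ?thesis
    using cong[of "\<lambda>x. x"] cong[of "\<lambda>_. 1"] sets by (simp add: centroid_def measure_gaussian_eq_integral)
qed

lemma voronoi_altdef:
  assumes i: "i \<in> {1..n}"
  shows "voronoi n y i
    = {x. \<forall>j\<in>{1..n}. (i < j \<longrightarrow> x \<le> (y i + y j) / 2) \<and> (j < i \<longrightarrow> (y j + y i) / 2 \<le> x)}"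
proof -
  have "dist x (y i) \<le> dist x (y j)
      \<longleftrightarrow> (i < j \<longrightarrow> x \<le> (y i + y j) / 2) \<and> (j < i \<longrightarrow> (y j + y i) / 2 \<le> x)"
    if j: "j \<in> {1..n}" for x j
    using strict_mono_onD[OF mono_y i j] strict_mono_onD[OF mono_y j i]
    by (cases i j rule: linorder_cases) (auto simp: dist_real_def abs_real_def field_simps)
  then show ?thesis unfolding voronoi_def by blast
qed

text \<open>The cell of \<open>y i\<close> is cut out by half-lines, one for each other level. As
  the levels increase, those of the adjacent levels are the tightest, and they end at the
  thresholds.\<close>

lemma closure_bin_eq_voronoi:
  assumes mid: "\<forall>i\<in>{1..<n}. \<zeta> i = (y i + y (i + 1)) / 2" and i: "i \<in> {1..n}"
  shows "closure (bin n \<zeta> i) = voronoi n y i"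
proof -
  have y_le: "y a \<le> y b" if "a \<in> {1..n}" "b \<in> {1..n}" "a \<le> b" for a b
    using strict_mono_onD[OF mono_y that(1,2)] that(3) by (cases "a = b") auto
  have upper: "ereal x \<le> threshold n \<zeta> i \<longleftrightarrow> (\<forall>j\<in>{1..n}. i < j \<longrightarrow> x \<le> (y i + y j) / 2)" for x
  proof (cases "i = n")
    case False
    then have "threshold n \<zeta> i = ereal ((y i + y (i + 1)) / 2)"
      using i mid by (auto simp: threshold_def)
    moreover have "y (i + 1) \<le> y j" if "j \<in> {1..n}" "i < j" for j
      using that i by (intro y_le) auto
    moreover have "i + 1 \<in> {1..n}" using False i by auto
    ultimately show ?thesis by fastforce
  qed (use i in \<open>auto simp: threshold_def\<close>)
  have lower: "threshold n \<zeta> (i - 1) \<le> ereal x \<longleftrightarrow> (\<forall>j\<in>{1..n}. j < i \<longrightarrow> (y j + y i) / 2 \<le> x)" for x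
  proof (cases "i = 1")
    case False
    then have "threshold n \<zeta> (i - 1) = ereal ((y (i - 1) + y i) / 2)"
      using i mid[rule_format, of "i - 1"] by (cases i) (auto simp: threshold_def)
    moreover have "y j \<le> y (i - 1)" if "j \<in> {1..n}" "j < i" for j
      using that i by (intro y_le) auto
    moreover have "i - 1 \<in> {1..n}" "i - 1 < i" using False i by auto
    ultimately show ?thesis by fastforce
  qed (auto simp: threshold_def)
  show ?thesis
    unfolding closure_bin[OF i] voronoi_altdef[OF i] upper lower by blast
qed

text \<open>The threshold lies in both adjacent closed bins, hence in both cells, and is therefore
  equidistant from the two levels.\<close>

lemma voronoi_imp_midpoint:
  assumes vor: "\<And>i. i \<in> {1..n} \<Longrightarrow> closure (bin n \<zeta> i) = voronoi n y i" and i: "i \<in> {1..<n}"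
  shows "\<zeta> i = (y i + y (i + 1)) / 2"
proof -
  have thr: "threshold n \<zeta> i = ereal (\<zeta> i)" using i by (auto simp: threshold_def)
  have in_i: "i \<in> {1..n}" "i + 1 \<in> {1..n}" using i by auto
  have "threshold n \<zeta> (i - 1) < threshold n \<zeta> i" "threshold n \<zeta> i < threshold n \<zeta> (i + 1)"
    using i by (auto intro!: threshold_less[OF mono_\<zeta>])
  then have "\<zeta> i \<in> closure (bin n \<zeta> i)" "\<zeta> i \<in> closure (bin n \<zeta> (i + 1))"
    unfolding closure_bin[OF in_i(1)] closure_bin[OF in_i(2)] using thr by auto
  then have "\<zeta> i \<in> voronoi n y i" "\<zeta> i \<in> voronoi n y (i + 1)"
    using vor in_i by auto
  then have "dist (\<zeta> i) (y i) = dist (\<zeta> i) (y (i + 1))"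
    unfolding voronoi_def using in_i by (intro antisym) auto
  then show ?thesis
    using y_less[OF i] by (auto simp: dist_real_def abs_real_def split: if_splits)
qed

lemma centroid_midpoint_iff_voronoi:
  "(\<forall>i\<in>{1..n}. y i = centroid P (bin n \<zeta> i)) \<and> (\<forall>i\<in>{1..<n}. \<zeta> i = (y i + y (i + 1)) / 2) \<longleftrightarrow>
    (\<forall>i\<in>{1..n}. closure (bin n \<zeta> i) = voronoi n y i \<and> y i = centroid P (voronoi n y i))"
  using closure_bin_eq_voronoi voronoi_imp_midpoint centroid_closure_bin by metis

section \<open>Limits of stationary points\<close>

lemma tendsto_bin_integral:
  fixes g :: "real \<Rightarrow> real"
  assumes g: "integrable P g" "continuous_on UNIV g" and i: "i \<in> {1..n}"
    and Z: "\<And>m. strict_mono_on {1..<n} (Z m)" "\<And>i. i \<in> {1..<n} \<Longrightarrow> ((\<lambda>m. Z m i) \<longlongrightarrow> \<zeta> i) F"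
  shows "((\<lambda>m. LINT x:bin n (Z m) i|P. g x) \<longlongrightarrow> (LINT x:bin n \<zeta> i|P. g x)) F"
proof -
  have "((\<lambda>m. cum \<sigma> g (threshold n (Z m) k)) \<longlongrightarrow> cum \<sigma> g (threshold n \<zeta> k)) F" if "k \<le> n" for k
  proof (cases "k = 0 \<or> k = n")
    case False
    then have "k \<in> {1..<n}" using that by auto
    then have "((\<lambda>m. cum \<sigma> g (ereal (Z m k))) \<longlongrightarrow> cum \<sigma> g (ereal (\<zeta> k))) F"
      by (intro isCont_tendsto_compose[OF DERIV_isCont[OF cum_has_real_derivative[OF \<sigma>_pos g]]] Z)
    then show ?thesis using False by (simp add: threshold_def)
  qed (auto simp: threshold_def)
  then show ?thesis
    unfolding bin_integral[OF Z(1) i g(1)] bin_integral[OF mono_\<zeta> i g(1)]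
    using i by (intro tendsto_diff) auto
qed

text \<open>Numerator and denominator are both continuous in the thresholds. The limiting
  denominator is nonzero because the limiting thresholds are still strictly ordered.\<close>

lemma tendsto_centroid_bin:
  assumes i: "i \<in> {1..n}"
    and Z: "\<And>m. strict_mono_on {1..<n} (Z m)" "\<And>i. i \<in> {1..<n} \<Longrightarrow> ((\<lambda>m. Z m i) \<longlongrightarrow> \<zeta> i) F"
  shows "((\<lambda>m. centroid P (bin n (Z m) i)) \<longlongrightarrow> centroid P (bin n \<zeta> i)) F"
proof -
  interpret G: prob_space P by (rule prob_space_gaussian[OF \<sigma>_pos])
  have "((\<lambda>m. LINT x:bin n (Z m) i|P. x) \<longlongrightarrow> (LINT x:bin n \<zeta> i|P. x)) F"
    using integrable_gaussian_power[OF \<sigma>_pos, of 1] by (intro tendsto_bin_integral i Z) auto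
  moreover have "((\<lambda>m. LINT x:bin n (Z m) i|P. 1) \<longlongrightarrow> (LINT x:bin n \<zeta> i|P. (1::real))) F"
    by (intro tendsto_bin_integral i Z) auto
  moreover have "(LINT x:bin n \<zeta> i|P. (1::real)) \<noteq> 0"
    using w_pos[OF i] by (simp add: weight_def measure_gaussian_eq_integral)
  ultimately show ?thesis
    unfolding centroid_def measure_gaussian_eq_integral[OF bin_measurable] by (intro tendsto_divide)
qed

end

lemma tendsto_zero_of_inverse_square_bound:
  fixes f k :: "'a \<Rightarrow> real"
  assumes "filterlim k at_top F" and "\<And>x. \<bar>f x\<bar> \<le> L / (2 * (k x)\<^sup>2)"
  shows "(f \<longlongrightarrow> 0) F"
proof (rule Lim_null_comparison)
  have "((\<lambda>x. L / 2 * (inverse (k x))\<^sup>2) \<longlongrightarrow> L / 2 * 0\<^sup>2) F"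
    by (intro tendsto_intros tendsto_inverse_0_at_top assms(1))
  then show "((\<lambda>x. L / (2 * (k x)\<^sup>2)) \<longlongrightarrow> 0) F"
    by (simp add: power_inverse field_simps)
  show "\<forall>\<^sub>F x in F. norm (f x) \<le> L / (2 * (k x)\<^sup>2)"
    using assms(2) by simp
qed

text \<open>The residuals of the centroid and midpoint equations equal the corrections, which tend
  to 0 because convergent levels are uniformly bounded. The residuals also converge to those of the
  limit, so the latter vanish.\<close>

lemma limit_of_stationary_points:
  fixes k :: "nat \<Rightarrow> real"
  assumes \<sigma>: "\<sigma> > 0" and n: "n \<ge> 1" and k: "filterlim k at_top sequentially"
    and adm: "\<And>m. admissible n (Y m) (Z m)"
    and stat: "\<And>m. stationary n (objective (gaussian \<sigma>) n (k m)) (Y m) (Z m)"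
    and adm0: "admissible n y \<zeta>"
    and Y: "\<And>i. i \<in> {1..n} \<Longrightarrow> (\<lambda>m. Y m i) \<longlonglongrightarrow> y i"
    and Z: "\<And>i. i \<in> {1..<n} \<Longrightarrow> (\<lambda>m. Z m i) \<longlonglongrightarrow> \<zeta> i"
  shows "(\<forall>i\<in>{1..n}. y i = centroid (gaussian \<sigma>) (bin n \<zeta> i)) \<and> (\<forall>i\<in>{1..<n}. \<zeta> i = (y i + y (i + 1)) / 2)"
proof -
  interpret lim: gaussian_quantizer \<sigma> n y \<zeta> using \<sigma> n adm0 by unfold_locales
  have q: "gaussian_quantizer \<sigma> n (Y m) (Z m)" for m using \<sigma> n adm by unfold_locales
  have mono_Z: "strict_mono_on {1..<n} (Z m)" for m using adm by (simp add: admissible_def)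
  have "\<exists>B. \<forall>m. \<bar>Y m i\<bar> \<le> B" if "i \<in> {1..n}" for i
    using convergent_imp_Bseq[OF convergentI[OF Y[OF that]]] by (auto simp: Bseq_def)
  then obtain B where B: "\<And>i m. i \<in> {1..n} \<Longrightarrow> \<bar>Y m i\<bar> \<le> B i" by metis
  define R where "R = (\<Sum>i=1..n. \<bar>B i\<bar>)"
  have R: "\<bar>Y m j\<bar> \<le> R" if "j \<in> {1..n}" for m j
  proof -
    have "\<bar>Y m j\<bar> \<le> \<bar>B j\<bar>" using B[OF that, of m] by linarith
    also have "\<dots> \<le> R" unfolding R_def using that by (intro member_le_sum) auto
    finally show ?thesis .
  qed
  \<comment> \<open>The equations at a stationary point require positive \<open>k m\<close>, which
    divergence gives only eventually.\<close>
  have ev: "\<forall>\<^sub>F m in sequentially. k m > 0"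
    using k by (rule filterlim_at_top_dense[THEN iffD1, rule_format])
  show ?thesis
  proof (intro conjI ballI)
    fix i assume i: "i \<in> {1..n}"
    have "(\<lambda>m. level_correction (gaussian \<sigma>) n (k m) (Y m) (Z m) i) \<longlonglongrightarrow> 0"
      by (rule tendsto_zero_of_inverse_square_bound[OF k gaussian_quantizer.level_correction_bound[OF q i R]])
    moreover have "\<forall>\<^sub>F m in sequentially. level_correction (gaussian \<sigma>) n (k m) (Y m) (Z m) i
        = Y m i - centroid (gaussian \<sigma>) (bin n (Z m) i)"
      using ev by eventually_elim (use gaussian_quantizer.stationary_objective_iff[OF q] stat i in metis)
    ultimately have "(\<lambda>m. Y m i - centroid (gaussian \<sigma>) (bin n (Z m) i)) \<longlonglongrightarrow> 0"
      by (rule Lim_transform_eventually)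
    moreover have "(\<lambda>m. Y m i - centroid (gaussian \<sigma>) (bin n (Z m) i)) \<longlonglongrightarrow> y i - centroid (gaussian \<sigma>) (bin n \<zeta> i)"
      by (intro tendsto_diff Y i lim.tendsto_centroid_bin mono_Z Z)
    ultimately show "y i = centroid (gaussian \<sigma>) (bin n \<zeta> i)"
      using LIMSEQ_unique by fastforce
  next
    fix i assume i: "i \<in> {1..<n}"
    have "(\<lambda>m. threshold_correction (gaussian \<sigma>) n (k m) (Y m) (Z m) i) \<longlonglongrightarrow> 0"
      by (rule tendsto_zero_of_inverse_square_bound[OF k gaussian_quantizer.threshold_correction_bound[OF q i R]])
    moreover have "\<forall>\<^sub>F m in sequentially. threshold_correction (gaussian \<sigma>) n (k m) (Y m) (Z m) i
        = Z m i - (Y m i + Y m (i + 1)) / 2"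
      using ev
    proof eventually_elim
      case (elim m)
      then have "Z m i = (Y m i + Y m (i + 1)) / 2 + threshold_correction (gaussian \<sigma>) n (k m) (Y m) (Z m) i"
        using gaussian_quantizer.stationary_objective_iff[OF q] stat i by metis
      then show ?case by simp
    qed
    ultimately have "(\<lambda>m. Z m i - (Y m i + Y m (i + 1)) / 2) \<longlonglongrightarrow> 0"
      by (rule Lim_transform_eventually)
    moreover have "(\<lambda>m. Z m i - (Y m i + Y m (i + 1)) / 2) \<longlonglongrightarrow> \<zeta> i - (y i + y (i + 1)) / 2"
      using i by (intro tendsto_intros Y Z) auto
    ultimately show "\<zeta> i = (y i + y (i + 1)) / 2"
      using LIMSEQ_unique by fastforce
  qed
qed

text \<open>The passage to large \<open>k\<close> is made precise in two ways: the corrections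
  vanish for each fixed quantizer, and every admissible limit of stationary points along a diverging
  \<open>k\<close> satisfies the centroid and midpoint equations.\<close>

theorem corollary4p10:
  fixes \<sigma> :: real and n :: nat
  assumes "\<sigma> > 0" and "n \<ge> 1"
  shows
    "(\<forall>y \<zeta>. admissible n y \<zeta> \<longrightarrow>
        (\<forall>i\<in>{1..n}. mmse_slice n (weight (gaussian \<sigma>) n \<zeta>) y i differentiable (at (y i)))
      \<and> (\<forall>k>0. stationary n (objective (gaussian \<sigma>) n k) y \<zeta> \<longleftrightarrow>
            (\<forall>i\<in>{1..n}. y i - centroid (gaussian \<sigma>) (bin n \<zeta> i)
                          = level_correction (gaussian \<sigma>) n k y \<zeta> i)
          \<and> (\<forall>i\<in>{1..<n}. \<zeta> i = (y i + y (i + 1)) / 2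
                          + threshold_correction (gaussian \<sigma>) n k y \<zeta> i))
      \<and> (\<forall>i\<in>{1..n}. ((\<lambda>k. level_correction (gaussian \<sigma>) n k y \<zeta> i) \<longlongrightarrow> 0) at_top)
      \<and> (\<forall>i\<in>{1..<n}. ((\<lambda>k. threshold_correction (gaussian \<sigma>) n k y \<zeta> i) \<longlongrightarrow> 0) at_top)
      \<and> (lloyd_max (gaussian \<sigma>) n y \<zeta> \<longleftrightarrow>
            (\<forall>i\<in>{1..n}. y i = centroid (gaussian \<sigma>) (bin n \<zeta> i))
          \<and> (\<forall>i\<in>{1..<n}. \<zeta> i = (y i + y (i + 1)) / 2))
      \<and> ((\<forall>i\<in>{1..n}. y i = centroid (gaussian \<sigma>) (bin n \<zeta> i))
          \<and> (\<forall>i\<in>{1..<n}. \<zeta> i = (y i + y (i + 1)) / 2)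
         \<longleftrightarrow>
            (\<forall>i\<in>{1..n}. closure (bin n \<zeta> i) = voronoi n y i
                      \<and> y i = centroid (gaussian \<sigma>) (voronoi n y i))))
   \<and> (\<forall>(k :: nat \<Rightarrow> real) Y Z y \<zeta>.
        filterlim k at_top sequentially \<longrightarrow>
        (\<forall>m. admissible n (Y m) (Z m) \<and> stationary n (objective (gaussian \<sigma>) n (k m)) (Y m) (Z m)) \<longrightarrow>
        admissible n y \<zeta> \<longrightarrow>
        (\<forall>i\<in>{1..n}. (\<lambda>m. Y m i) \<longlonglongrightarrow> y i) \<longrightarrow>
        (\<forall>i\<in>{1..<n}. (\<lambda>m. Z m i) \<longlonglongrightarrow> \<zeta> i) \<longrightarrow>
        (\<forall>i\<in>{1..n}. y i = centroid (gaussian \<sigma>) (bin n \<zeta> i))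
      \<and> (\<forall>i\<in>{1..<n}. \<zeta> i = (y i + y (i + 1)) / 2))"
proof (rule conjI; intro allI impI)
  fix y \<zeta> :: "nat \<Rightarrow> real"
  assume adm: "admissible n y \<zeta>"
  interpret gaussian_quantizer \<sigma> n y \<zeta> using assms adm by unfold_locales
  obtain R where R: "\<And>j. j \<in> {1..n} \<Longrightarrow> \<bar>y j\<bar> \<le> R" using post_bounded by metis
  have differentiable: "\<forall>i\<in>{1..n}. mmse_slice n W y i differentiable (at (y i))"
    using mmse_slice_has_real_derivative real_differentiable_def by blast
  have level: "\<forall>i\<in>{1..n}. ((\<lambda>k. level_correction P n k y \<zeta> i) \<longlongrightarrow> 0) at_top"
    by (intro ballI, rule tendsto_zero_of_inverse_square_bound[OF filterlim_ident level_correction_bound[OF _ R]])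
  have threshold: "\<forall>i\<in>{1..<n}. ((\<lambda>k. threshold_correction P n k y \<zeta> i) \<longlongrightarrow> 0) at_top"
    by (intro ballI, rule tendsto_zero_of_inverse_square_bound[OF filterlim_ident threshold_correction_bound[OF _ R]])
  show "(\<forall>i\<in>{1..n}. mmse_slice n (weight (gaussian \<sigma>) n \<zeta>) y i differentiable (at (y i)))
      \<and> (\<forall>k>0. stationary n (objective (gaussian \<sigma>) n k) y \<zeta> \<longleftrightarrow>
            (\<forall>i\<in>{1..n}. y i - centroid (gaussian \<sigma>) (bin n \<zeta> i)
                          = level_correction (gaussian \<sigma>) n k y \<zeta> i)
          \<and> (\<forall>i\<in>{1..<n}. \<zeta> i = (y i + y (i + 1)) / 2
                          + threshold_correction (gaussian \<sigma>) n k y \<zeta> i))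
      \<and> (\<forall>i\<in>{1..n}. ((\<lambda>k. level_correction (gaussian \<sigma>) n k y \<zeta> i) \<longlongrightarrow> 0) at_top)
      \<and> (\<forall>i\<in>{1..<n}. ((\<lambda>k. threshold_correction (gaussian \<sigma>) n k y \<zeta> i) \<longlongrightarrow> 0) at_top)
      \<and> (lloyd_max (gaussian \<sigma>) n y \<zeta> \<longleftrightarrow>
            (\<forall>i\<in>{1..n}. y i = centroid (gaussian \<sigma>) (bin n \<zeta> i))
          \<and> (\<forall>i\<in>{1..<n}. \<zeta> i = (y i + y (i + 1)) / 2))
      \<and> ((\<forall>i\<in>{1..n}. y i = centroid (gaussian \<sigma>) (bin n \<zeta> i))
          \<and> (\<forall>i\<in>{1..<n}. \<zeta> i = (y i + y (i + 1)) / 2)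
         \<longleftrightarrow>
            (\<forall>i\<in>{1..n}. closure (bin n \<zeta> i) = voronoi n y i
                      \<and> y i = centroid (gaussian \<sigma>) (voronoi n y i)))"
    by (intro conjI differentiable level threshold lloyd_max_iff centroid_midpoint_iff_voronoi
        allI impI stationary_objective_iff)
next
  fix k :: "nat \<Rightarrow> real" and Y Z :: "nat \<Rightarrow> nat \<Rightarrow> real" and y \<zeta> :: "nat \<Rightarrow> real"
  assume "filterlim k at_top sequentially"
    and "\<forall>m. admissible n (Y m) (Z m) \<and> stationary n (objective (gaussian \<sigma>) n (k m)) (Y m) (Z m)"
    and "admissible n y \<zeta>"
    and "\<forall>i\<in>{1..n}. (\<lambda>m. Y m i) \<longlonglongrightarrow> y i" and "\<forall>i\<in>{1..<n}. (\<lambda>m. Z m i) \<longlonglongrightarrow> \<zeta> i"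
  then show "(\<forall>i\<in>{1..n}. y i = centroid (gaussian \<sigma>) (bin n \<zeta> i))
      \<and> (\<forall>i\<in>{1..<n}. \<zeta> i = (y i + y (i + 1)) / 2)"
    by (intro limit_of_stationary_points[OF assms, of k Y Z]) auto
qed

end
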